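(* Let $p\in\mathbb{Z}$ and let $\mu$ be a measure on $\mathbb{T}$. The following are true. (1) $\mu$ is an ergodic $\times p$-invariant measure if and only if $$\lim_{n\to\infty}\frac{1}{|F_n|}\sum_{j\in F_n}\hat{\mu}(kp^j+l)=\hat{\mu}(k)\hat{\mu}(l)$$ for every F\o lner sequence $\Sigma=\{F_n\}_{n=1}^\infty$ in $\mathbb{N}$ and all $k,l\in\mathbb{Z}$. (2) $\mu$ is a weakly mixing $\times p$-invariant measure if and only if $$\lim_{n\to\infty}\frac{1}{|F_n|}\sum_{j\in F_n}\left|\hat{\mu}(kp^j+l)-\hat{\mu}(k)\hat{\mu}(l)\right|^2=0$$ for every F\o lner sequence $\Sigma=\{F_n\}_{n=1}^\infty$ in $\mathbb{N}$ and all $k,l\in\mathbb{Z}$. (3) $\mu$ is a strongly mixing $\times p$-invariant measure if and only if $$\lim_{j\to\infty}\hat{\mu}(kp^j+l)=\hat{\mu}(k)\hat{\mu}(l)$$ for all $k,l\in\mathbb{Z}$.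
   Context: $\mathbb{N}$ is the set of nonnegative integers. $\mathbb{T}=\mathbb{R}/\mathbb{Z}$ is the unit circle, also identified with $\{z\in\mathbb{C}: |z|=1\}$. "Measure" always means Borel probability measure. The Fourier coefficient of $\mu$ at $n\in\mathbb{Z}$ is $\hat{\mu}(n)=\int_{\mathbb{T}}z^n\,d\mu(z)$ (with $\mathbb{T}=\{|z|=1\}$). The $\times p$ map is $T_p:\mathbb{T}\to\mathbb{T}$, $T_p(x)=px\bmod\mathbb{Z}$ for $x\in\mathbb{R}/\mathbb{Z}$. A measure $\mu$ is $\times p$-invariant if it is $T_p$-invariant, i.e. $\mu(T_p^{-1}B)=\mu(B)$ for all Borel $B$. For a continuous map $T:X\to X$ of a compact metrizable space, a $T$-invariant measure $\mu$ is: ergodic if every Borel $B$ with $T^{-1}B=B$ satisfies $\mu(B)^2=\mu(B)$; weakly mixing if $\mu\times\mu$ is an ergodic $T\times T$-invariant measure on $X\times X$; strongly mixing if $\lim_{j\to\infty}\mu(T^{-j}A\cap B)=\mu(A)\mu(B)$ for all Borel $A,B\subseteq X$. Here these are used with $X=\mathbb{T}$, $T=T_p$. A sequence $\{F_n\}_{n=1}^\infty$ of finite (nonempty) subsets of $\mathbb{N}$ is a F\o lner sequence if $\lim_{n\to\infty}\frac{|(F_n+m)\Delta F_n|}{|F_n|}=0$ for every $m\in\mathbb{N}$. *)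

theory Defs
  imports "HOL-Probability.Probability"
begin

abbreviation unit_circle :: "complex set" where
  "unit_circle \<equiv> sphere 0 1"

text \<open>Borel probability measures on the unit circle; the underlying set is the circle itself,
  not the whole complex plane.\<close>
definition circle_measure :: "complex measure \<Rightarrow> bool" where
  "circle_measure \<mu> \<longleftrightarrow> prob_space \<mu> \<and> sets \<mu> = sets (restrict_space borel unit_circle)"

definition fourier_coeff :: "complex measure \<Rightarrow> int \<Rightarrow> complex" where
  "fourier_coeff \<mu> n = (LINT z|\<mu>. z powi n)"

text \<open>Under the identification of the class of \<open>x\<close> in \<open>\<real>/\<int>\<close> with \<open>cis (2 * pi * x)\<close>,
  multiplication by \<open>p\<close> on \<open>\<real>/\<int>\<close> becomes the \<open>p\<close>-th power map on the unit circle.\<close>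
definition times_map :: "int \<Rightarrow> complex \<Rightarrow> complex" where
  "times_map p z = z powi p"

lemma times_map_cis: "times_map p (cis (2 * pi * x)) = cis (2 * pi * (of_int p * x))"
  by (simp add: times_map_def cis_power_int mult_ac)

definition invariant_measure :: "('a \<Rightarrow> 'a) \<Rightarrow> 'a measure \<Rightarrow> bool" where
  "invariant_measure T M \<longleftrightarrow> T \<in> M \<rightarrow>\<^sub>M M \<and>
     (\<forall>B\<in>sets M. emeasure M (T -` B \<inter> space M) = emeasure M B)"

definition ergodic_measure :: "('a \<Rightarrow> 'a) \<Rightarrow> 'a measure \<Rightarrow> bool" where
  "ergodic_measure T M \<longleftrightarrow> invariant_measure T M \<and>
     (\<forall>B\<in>sets M. T -` B \<inter> space M = B \<longrightarrow> (measure M B)\<^sup>2 = measure M B)"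

text \<open>For a second countable space, as here, the product sigma-algebra of the Borel sets is
  the Borel sigma-algebra of the product.\<close>
definition weakly_mixing_measure :: "('a \<Rightarrow> 'a) \<Rightarrow> 'a measure \<Rightarrow> bool" where
  "weakly_mixing_measure T M \<longleftrightarrow> invariant_measure T M \<and>
     ergodic_measure (map_prod T T) (M \<Otimes>\<^sub>M M)"

definition strongly_mixing_measure :: "('a \<Rightarrow> 'a) \<Rightarrow> 'a measure \<Rightarrow> bool" where
  "strongly_mixing_measure T M \<longleftrightarrow> invariant_measure T M \<and>
     (\<forall>A\<in>sets M. \<forall>B\<in>sets M.
        (\<lambda>j. measure M ((T ^^ j) -` A \<inter> B)) \<longlonglongrightarrow> measure M A * measure M B)"

text \<open>The sequence is indexed from 0, which does not affect any of the limits.\<close>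
definition folner_sequence :: "(nat \<Rightarrow> nat set) \<Rightarrow> bool" where
  "folner_sequence F \<longleftrightarrow> (\<forall>n. finite (F n) \<and> F n \<noteq> {}) \<and>
     (\<forall>m. (\<lambda>n. real (card (sym_diff ((\<lambda>x. x + m) ` F n) (F n))) / real (card (F n)))
            \<longlonglongrightarrow> 0)"

end

theory Submission imports Defs begin

text \<open>
Write \<open>C\<^sub>j(f, g) = \<integral> f(T\<^sup>j x) g(x)\<close> for the correlations of a system. On the circle, with
\<open>T = times_map p\<close>, one has \<open>C\<^sub>j(z\<^sup>k, z\<^sup>l) = fourier_coeff (k p\<^sup>j + l)\<close>, so the three conditions on Fourier
coefficients are exactly the correlation limits of ergodicity, weak mixing and strong mixing, tested on
characters only. Two facts therefore suffice: the mixing properties imply the correlation limits for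
all bounded measurable functions, and limits tested on characters extend to indicators of Borel sets.

From coefficients to mixing. First, \<open>T\<close> preserves the measure: with \<open>l = 0\<close> the averages of
\<open>fourier_coeff (k p\<^sup>j)\<close> tend to \<open>fourier_coeff k\<close>; replacing \<open>k\<close> by \<open>k p\<close> shifts the sequence by one, which
does not change limits along a Folner sequence, so \<open>fourier_coeff (k p) = fourier_coeff k\<close>, and Fourier
coefficients determine a measure (\<open>times_map_invariant_of_mean_limit\<close>). Given invariance, \<open>C\<^sub>j(f, g)\<close> is
bounded, uniformly in \<open>j\<close>, by a sup norm of one argument times the \<open>L\<^sup>1\<close> norm of the other. Hence the set of
functions for which the limit holds is closed under linear combinations and under bounded pointwise
limits, in each argument (\<open>correlation_limit_extension\<close>). The closure of the characters under these
operations contains the continuous functions, by Stone--Weierstrass, then the indicators of closed sets,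
and then those of all Borel sets (\<open>indicator_in_bp_closure_characters\<close>). For an invariant set \<open>B\<close> all
correlations of its indicator with itself equal \<open>measure B\<close>, so the limit gives
\<open>measure B = (measure B)\<^sup>2\<close>. For weak mixing the same argument runs on the product system, where the
correlations of tensor products multiply and mean square convergence of each factor gives convergence
of the means of the product.

From mixing to coefficients. For ergodic systems this is von Neumann's mean ergodic theorem along a
Folner sequence (\<open>mean_ergodic_folner\<close>), proved by a convexity argument. For a bounded real \<open>f\<close> with mean
zero, consider the functions generated from \<open>f\<close> by composition with \<open>T\<close> and midpoints. A minimising
sequence \<open>h\<^sub>k\<close> for the \<open>L\<^sup>2\<close> norm is Cauchy by the parallelogram law, which also makes \<open>h\<^sub>k \<circ> T - h\<^sub>k\<close>
tend to zero; the limit is invariant, hence zero by ergodicity, so there are functions \<open>h\<close> of arbitrarily small norm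
(\<open>orbit_hull_small\<close>). Folner averages of \<open>f\<close> and of \<open>h\<close> differ by a uniformly small amount, and the
averages of \<open>h\<close> are no larger than \<open>h\<close> in \<open>L\<^sup>2\<close>. For weak mixing, apply this to the product system: with
\<open>c\<close> the product of the two means, expand \<open>|C\<^sub>j - c|\<^sup>2\<close> and note that \<open>|C\<^sub>j|\<^sup>2\<close> and \<open>C\<^sub>j\<close> are both correlations
of tensor products. For strong mixing the limits for indicators are given, and every bounded measurable
function is in the bounded pointwise closure of the indicators.
\<close>

section \<open>Bounded pointwise closure\<close>

text \<open>Convergence is required on \<open>X\<close> only, so that functions may be altered freely outside \<open>X\<close>; here \<open>X\<close> is
the space of a measure.\<close>

inductive_set bp_closure :: "'a set \<Rightarrow> ('a \<Rightarrow> complex) set \<Rightarrow> ('a \<Rightarrow> complex) set"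
  for X :: "'a set" and G :: "('a \<Rightarrow> complex) set" where
  base: "f \<in> G \<Longrightarrow> f \<in> bp_closure X G"
| add: "f \<in> bp_closure X G \<Longrightarrow> g \<in> bp_closure X G \<Longrightarrow> (\<lambda>x. f x + g x) \<in> bp_closure X G"
| scale: "f \<in> bp_closure X G \<Longrightarrow> (\<lambda>x. c * f x) \<in> bp_closure X G"
| limit: "(\<And>i. f i \<in> bp_closure X G) \<Longrightarrow> (\<And>i x. x \<in> X \<Longrightarrow> norm (f i x) \<le> K) \<Longrightarrow>
    (\<And>x. x \<in> X \<Longrightarrow> (\<lambda>i. f i x) \<longlonglongrightarrow> g x) \<Longrightarrow> g \<in> bp_closure X G" for f :: "nat \<Rightarrow> 'a \<Rightarrow> complex"

definition bounded_measurable :: "'a measure \<Rightarrow> ('a \<Rightarrow> complex) \<Rightarrow> bool" where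
  "bounded_measurable M f \<longleftrightarrow> f \<in> borel_measurable M \<and> (\<exists>K. \<forall>x\<in>space M. norm (f x) \<le> K)"

lemma bp_closure_bounded:
  assumes "f \<in> bp_closure X G" and "\<And>g. g \<in> G \<Longrightarrow> \<exists>K. \<forall>x\<in>X. norm (g x) \<le> K"
  shows "\<exists>K. \<forall>x\<in>X. norm (f x) \<le> K"
  using assms(1)
proof induction
  case (base f)
  then show ?case by (rule assms(2))
next
  case (add f g)
  then obtain K L where "\<forall>x\<in>X. norm (f x) \<le> K" "\<forall>x\<in>X. norm (g x) \<le> L"
    by blast
  then have "\<forall>x\<in>X. norm (f x + g x) \<le> K + L"
    by (meson add_mono norm_triangle_le)
  then show ?case by blast
next
  case (scale f c)
  then obtain K where "\<forall>x\<in>X. norm (f x) \<le> K" by blast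
  then have "\<forall>x\<in>X. norm (c * f x) \<le> norm c * K"
    by (auto simp: norm_mult intro: mult_left_mono)
  then show ?case by blast
next
  case (limit f K g)
  have "norm (g x) \<le> K" if "x \<in> X" for x
    by (rule LIMSEQ_le_const2[OF tendsto_norm[OF limit.hyps(3)[OF that]]]) (use limit.hyps(2) that in blast)
  then show ?case by blast
qed

lemma bp_closure_cong:
  assumes "f \<in> bp_closure X G" and "\<And>g. g \<in> G \<Longrightarrow> \<exists>K. \<forall>x\<in>X. norm (g x) \<le> K"
    and "\<And>x. x \<in> X \<Longrightarrow> f x = g x"
  shows "g \<in> bp_closure X G"
proof -
  obtain K where K: "\<forall>x\<in>X. norm (f x) \<le> K"
    using bp_closure_bounded[OF assms(1,2)] by blast
  show ?thesis
    by (rule bp_closure.limit[where f = "\<lambda>_. f" and K = K]) (use assms K in auto)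
qed

lemma bp_closure_bounded_measurable:
  assumes "f \<in> bp_closure (space M) G" and "\<And>g. g \<in> G \<Longrightarrow> bounded_measurable M g"
  shows "bounded_measurable M f"
proof -
  have "f \<in> borel_measurable M"
    using assms(1)
  proof induction
    case (base f)
    then show ?case using assms(2) by (auto simp: bounded_measurable_def)
  next
    case (limit f K g)
    show ?case
      by (rule borel_measurable_LIMSEQ_metric[where f = f]) (use limit in auto)
  qed auto
  moreover have "\<exists>K. \<forall>x\<in>space M. norm (f x) \<le> K"
    by (rule bp_closure_bounded[OF assms(1)]) (use assms(2) in \<open>auto simp: bounded_measurable_def\<close>)
  ultimately show ?thesis by (simp add: bounded_measurable_def)
qed

text \<open>Fix a generator in the second argument and induct on the first, then fix the first argument and induct
on the second. Three generating sets are allowed because the lemma is used both for the product of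
characters on the circle and for the product of functions of the two coordinates of a product space.\<close>

lemma bp_closure_mult:
  assumes f: "f \<in> bp_closure X G" and g: "g \<in> bp_closure X H"
    and G: "\<And>g. g \<in> G \<Longrightarrow> \<exists>K. \<forall>x\<in>X. norm (g x) \<le> K"
    and H: "\<And>g. g \<in> H \<Longrightarrow> \<exists>K. \<forall>x\<in>X. norm (g x) \<le> K"
    and GH: "\<And>f g. f \<in> G \<Longrightarrow> g \<in> H \<Longrightarrow> (\<lambda>x. f x * g x) \<in> bp_closure X E"
  shows "(\<lambda>x. f x * g x) \<in> bp_closure X E"
proof -
  have gen: "(\<lambda>x. f x * g x) \<in> bp_closure X E" if "g \<in> H" for g
    using f
  proof induction
    case (base f)
    then show ?case using GH that by blast
  next
    case (add f1 f2)
    then show ?case using bp_closure.add[OF add.IH] by (simp add: algebra_simps)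
  next
    case (scale f c)
    then show ?case using bp_closure.scale[OF scale.IH, of c] by (simp add: algebra_simps)
  next
    case (limit f K h)
    obtain L where L: "\<forall>x\<in>X. norm (g x) \<le> L" using H[OF \<open>g \<in> H\<close>] by blast
    show ?case
    proof (rule bp_closure.limit[where f = "\<lambda>i x. f i x * g x" and K = "K * L"])
      show "(\<lambda>x. f i x * g x) \<in> bp_closure X E" for i by (rule limit)
      show "norm (f i x * g x) \<le> K * L" if "x \<in> X" for i x
      proof -
        have "0 \<le> K" using limit.hyps(2)[OF that, of i] norm_ge_zero[of "f i x"] by linarith
        then show ?thesis using limit.hyps(2)[OF that, of i] L that
          by (auto simp: norm_mult intro!: mult_mono)
      qed
      show "(\<lambda>i. f i x * g x) \<longlonglongrightarrow> h x * g x" if "x \<in> X" for x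
        by (intro tendsto_intros limit that)
    qed
  qed
  obtain L where L: "\<forall>x\<in>X. norm (f x) \<le> L" using bp_closure_bounded[OF f G] by blast
  show ?thesis
    using g
  proof induction
    case (base g)
    then show ?case by (rule gen)
  next
    case (add f1 f2)
    then show ?case using bp_closure.add[OF add.IH] by (simp add: algebra_simps)
  next
    case (scale f c)
    then show ?case using bp_closure.scale[OF scale.IH, of c] by (simp add: algebra_simps)
  next
    case (limit g K h)
    show ?case
    proof (rule bp_closure.limit[where f = "\<lambda>i x. f x * g i x" and K = "L * K"])
      show "(\<lambda>x. f x * g i x) \<in> bp_closure X E" for i by (rule limit)
      show "norm (f x * g i x) \<le> L * K" if "x \<in> X" for i x
      proof -
        have "0 \<le> L" using L that norm_ge_zero[of "f x"] order_trans by blast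
        then show ?thesis using limit.hyps(2)[OF that, of i] L that
          by (auto simp: norm_mult intro!: mult_mono)
      qed
      show "(\<lambda>i. f x * g i x) \<longlonglongrightarrow> f x * h x" if "x \<in> X" for x
        by (intro tendsto_intros limit that)
    qed
  qed
qed

lemma bp_closure_compose:
  assumes "f \<in> bp_closure Y G" and "\<And>x. x \<in> X \<Longrightarrow> \<phi> x \<in> Y"
  shows "(\<lambda>x. f (\<phi> x)) \<in> bp_closure X ((\<lambda>f x. f (\<phi> x)) ` G)"
  using assms(1)
proof induction
  case (limit f K g)
  show ?case
    by (rule bp_closure.limit[where f = "\<lambda>i x. f i (\<phi> x)" and K = K]) (use limit assms(2) in auto)
qed (auto intro: bp_closure.intros)

lemma bp_closure_sum:
  assumes "(\<lambda>_. 1) \<in> bp_closure X G" and "\<And>i. i \<in> I \<Longrightarrow> f i \<in> bp_closure X G"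
  shows "(\<lambda>x. \<Sum>i\<in>I. f i x) \<in> bp_closure X G"
  using assms(2)
proof (induction I rule: infinite_finite_induct)
  case (insert i I)
  then show ?case using bp_closure.add[of "f i" X G "\<lambda>x. \<Sum>i\<in>I. f i x"] by simp
qed (use bp_closure.scale[OF assms(1), of 0] in auto)

text \<open>Dynkin's \<open>\<pi>\<close>-\<open>\<lambda>\<close> argument: sets with indicator in the closure are stable under complements and disjoint
countable unions. The ambient space \<open>\<Omega>\<close> may be larger than \<open>X\<close>; for the circle this lets the closed subsets
of the whole plane serve as generators.\<close>

lemma bp_closure_indicator:
  assumes "Int_stable \<A>" "\<A> \<subseteq> Pow \<Omega>" "X \<subseteq> \<Omega>" and "A \<in> sigma_sets \<Omega> \<A>"
    and one: "(\<lambda>_. 1) \<in> bp_closure X G"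
    and bdd: "\<And>g. g \<in> G \<Longrightarrow> \<exists>K. \<forall>x\<in>X. norm (g x) \<le> K"
    and gen: "\<And>A. A \<in> \<A> \<Longrightarrow> indicator A \<in> bp_closure X G"
  shows "indicator A \<in> bp_closure X G"
  using assms(1,2,4)
proof (induction rule: sigma_sets_induct_disjoint)
  case (basic A)
  then show ?case by (rule gen)
next
  case empty
  show ?case using bp_closure.scale[OF one, of 0] by (simp add: indicator_def)
next
  case (compl A)
  have "(\<lambda>x. 1 + (-1) * indicator A x) \<in> bp_closure X G"
    by (intro bp_closure.add one bp_closure.scale compl)
  then show ?case
    by (rule bp_closure_cong[OF _ bdd]) (use assms(3) in \<open>auto simp: indicator_def\<close>)
next
  case (union A)
  have eq: "(\<Sum>i<n. indicator (A i) x) = (indicator (\<Union>i<n. A i) x :: complex)" for n x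
    by (rule indicator_UN_disjoint[symmetric])
      (use union(1) in \<open>auto simp: disjoint_family_on_def\<close>)
  show ?case
  proof (rule bp_closure.limit[where f = "\<lambda>n x. \<Sum>i<n. indicator (A i) x" and K = 1])
    show "(\<lambda>x. \<Sum>i<n. indicator (A i) x) \<in> bp_closure X G" for n
      by (intro bp_closure_sum one union)
    show "norm (\<Sum>i<n. indicator (A i) x :: complex) \<le> 1" for n x
      unfolding eq by (simp add: indicator_def)
    show "(\<lambda>n. \<Sum>i<n. indicator (A i) x) \<longlonglongrightarrow> (indicator (\<Union>(range A)) x :: complex)" for x
      unfolding eq by (rule LIMSEQ_indicator_UN)
  qed
qed

lemma bounded_measurable_in_bp_closure_indicators:
  assumes "bounded_measurable M f"
  shows "f \<in> bp_closure (space M) (indicator ` sets M)"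
proof -
  obtain K where K: "\<And>x. x \<in> space M \<Longrightarrow> norm (f x) \<le> K"
    and f: "f \<in> borel_measurable M"
    using assms by (auto simp: bounded_measurable_def)
  obtain s where s: "\<And>i. simple_function M (s i)" "\<And>x. x \<in> space M \<Longrightarrow> (\<lambda>i. s i x) \<longlonglongrightarrow> f x"
    "\<And>i x. x \<in> space M \<Longrightarrow> dist (s i x) 0 \<le> 2 * dist (f x) 0"
    using borel_measurable_implies_sequence_metric[OF f, of 0] by blast
  have one: "(\<lambda>_. 1) \<in> bp_closure (space M) (indicator ` sets M)"
    by (rule bp_closure_cong[where f = "indicator (space M)"])
      (auto intro!: bp_closure.base imageI exI[of _ 1] simp: indicator_def)
  show ?thesis
  proof (rule bp_closure.limit[where f = s and K = "2 * K"])
    fix i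
    have "(\<lambda>x. \<Sum>y\<in>s i ` space M. y * indicator (s i -` {y} \<inter> space M) x)
        \<in> bp_closure (space M) (indicator ` sets M)"
      by (intro bp_closure_sum one bp_closure.scale bp_closure.base imageI)
        (use s(1) in \<open>auto simp: simple_function_def\<close>)
    then show "s i \<in> bp_closure (space M) (indicator ` sets M)"
    proof (rule bp_closure_cong)
      show "\<exists>K. \<forall>x\<in>space M. norm (g x) \<le> K" if "g \<in> indicator ` sets M" for g :: "'a \<Rightarrow> complex"
        using that by (auto intro!: exI[of _ 1] simp: indicator_def)
      show "(\<Sum>y\<in>s i ` space M. y * indicator (s i -` {y} \<inter> space M) x) = s i x"
        if "x \<in> space M" for x
      proof -
        have "(\<Sum>y\<in>s i ` space M. y * indicator (s i -` {y} \<inter> space M) x)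
          = (\<Sum>y\<in>s i ` space M. if s i x = y then y else 0)"
          by (intro sum.cong) (auto simp: indicator_def that)
        also have "\<dots> = s i x"
          using s(1)[of i] that by (subst sum.delta') (auto simp: simple_function_def)
        finally show ?thesis .
      qed
    qed
  next
    show "norm (s i x) \<le> 2 * K" if "x \<in> space M" for i x
      using s(3)[OF that, of i] K[OF that] by (simp add: dist_norm)
  qed (rule s)
qed

section \<open>Trigonometric polynomials generate the Borel functions of the circle\<close>

definition characters :: "(complex \<Rightarrow> complex) set" where
  "characters = range (\<lambda>k z. z powi k)"

lemma character_mem: "(\<lambda>z. z powi k) \<in> characters"
  by (simp add: characters_def)

lemma one_in_bp_closure_characters: "(\<lambda>_. 1) \<in> bp_closure X characters"
  using bp_closure.base[OF character_mem[of 0], of X] by simp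

lemma characters_bounded: "g \<in> characters \<Longrightarrow> \<exists>K. \<forall>z\<in>unit_circle. norm (g z) \<le> K"
  by (auto simp: characters_def norm_power_int)

text \<open>On the circle the conjugate of \<open>z\<close> is \<open>z powi (-1)\<close>, so that real and imaginary parts are combinations of
characters; products of characters are characters.\<close>

lemma real_polynomial_function_in_bp_closure:
  assumes "real_polynomial_function f"
  shows "(\<lambda>z. complex_of_real (f z)) \<in> bp_closure unit_circle characters"
  using assms
proof induction
  case (linear f)
  interpret bounded_linear f by fact
  let ?c = "(f 1 - \<i> * f \<i>) / 2" and ?d = "(f 1 + \<i> * f \<i>) / 2"
  \<comment> \<open>The coefficients come from \<open>f z = Re z * f 1 + Im z * f \<i>\<close>.\<close>
  have "(\<lambda>z. ?c * z powi 1 + ?d * z powi (-1)) \<in> bp_closure unit_circle characters"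
    by (intro bp_closure.add bp_closure.scale bp_closure.base character_mem)
  then show ?case
  proof (rule bp_closure_cong[OF _ characters_bounded])
    fix z :: complex assume z: "z \<in> unit_circle"
    then have "z * cnj z = 1" by (simp add: complex_norm_square[symmetric])
    then have inv: "inverse z = cnj z" by (metis inverse_unique)
    have "f z = f (Re z *\<^sub>R 1 + Im z *\<^sub>R \<i>)"
      by (rule arg_cong[where f = f]) (simp add: complex_eq_iff)
    also have "\<dots> = Re z * f 1 + Im z * f \<i>" by (simp add: add scale)
    finally have fz: "f z = Re z * f 1 + Im z * f \<i>" .
    show "?c * z powi 1 + ?d * z powi (-1) = complex_of_real (f z)"
      unfolding fz by (simp add: power_int_minus inv) (simp add: complex_eq_iff field_simps)
  qed
next
  case (const c)
  show ?case
    using bp_closure.scale[OF one_in_bp_closure_characters, of c] by simp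
next
  case (add f g)
  then show ?case using bp_closure.add[OF add.IH] by simp
next
  case (mult f g)
  have "(\<lambda>z. complex_of_real (f z) * complex_of_real (g z)) \<in> bp_closure unit_circle characters"
  proof (rule bp_closure_mult[OF mult.IH characters_bounded characters_bounded])
    fix f g assume "f \<in> characters" "g \<in> characters"
    then obtain k l where fg: "f = (\<lambda>z. z powi k)" "g = (\<lambda>z. z powi l)" by (auto simp: characters_def)
    show "(\<lambda>z. f z * g z) \<in> bp_closure unit_circle characters"
    proof (rule bp_closure_cong[OF bp_closure.base[OF character_mem[of "k + l"]] characters_bounded])
      show "z powi (k + l) = f z * g z" if "z \<in> unit_circle" for z
      proof -
        have "z \<noteq> 0" using that by auto
        then show ?thesis unfolding fg by (simp add: power_int_add)
      qed
    qed
  qed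
  then show ?case by simp
qed

lemma continuous_in_bp_closure:
  fixes f :: "complex \<Rightarrow> real"
  assumes "continuous_on unit_circle f"
  shows "(\<lambda>z. complex_of_real (f z)) \<in> bp_closure unit_circle characters"
proof -
  have "\<exists>g. real_polynomial_function g \<and> (\<forall>z\<in>unit_circle. \<bar>f z - g z\<bar> < inverse (Suc n))" for n
  proof -
    have pos: "inverse (real (Suc n)) > 0" by simp
    show ?thesis
    proof (rule Stone_Weierstrass_real_polynomial_function[OF compact_sphere assms pos])
      fix g
      assume "real_polynomial_function g"
        and "\<And>z. z \<in> unit_circle \<Longrightarrow> \<bar>f z - g z\<bar> < inverse (real (Suc n))"
      then show ?thesis by (intro exI[of _ g] conjI ballI)
    qed
  qed
  then have "\<exists>g. \<forall>n. real_polynomial_function (g n) \<and>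
      (\<forall>z\<in>unit_circle. \<bar>f z - g n z\<bar> < inverse (real (Suc n)))"
    by (intro choice allI)
  then obtain g where g: "\<And>n. real_polynomial_function (g n)"
    "\<And>n z. z \<in> unit_circle \<Longrightarrow> \<bar>f z - g n z\<bar> < inverse (Suc n)" by blast
  obtain K where "\<forall>y\<in>f ` unit_circle. norm y \<le> K"
    using compact_imp_bounded[OF compact_continuous_image[OF assms compact_sphere]]
    unfolding bounded_iff by blast
  then have K: "\<bar>f z\<bar> \<le> K" if "z \<in> unit_circle" for z
    using imageI[OF that, of f] by (metis real_norm_def)
  show ?thesis
  proof (rule bp_closure.limit[where f = "\<lambda>n z. complex_of_real (g n z)" and K = "K + 1"])
    show "norm (complex_of_real (g n z)) \<le> K + 1" if "z \<in> unit_circle" for n z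
    proof -
      have "inverse (real (Suc n)) \<le> 1" by (simp add: field_simps)
      then show ?thesis using g(2)[OF that, of n] K[OF that] by simp
    qed
    show "(\<lambda>n. complex_of_real (g n z)) \<longlonglongrightarrow> complex_of_real (f z)" if "z \<in> unit_circle" for z
    proof (intro tendsto_of_real, rule Lim_transform2)
      show "(\<lambda>n. f z) \<longlonglongrightarrow> f z" by simp
      show "(\<lambda>n. f z - g n z) \<longlonglongrightarrow> 0"
        by (rule Lim_null_comparison[OF always_eventually LIMSEQ_inverse_real_of_nat])
          (use g(2)[OF that] in \<open>auto intro: less_imp_le\<close>)
    qed
  qed (intro real_polynomial_function_in_bp_closure g)
qed

lemma indicator_in_bp_closure_characters:
  assumes "A \<in> sets borel"
  shows "indicator A \<in> bp_closure unit_circle characters"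
proof (rule bp_closure_indicator[where \<Omega> = UNIV and \<A> = "Collect closed"])
  show one: "(\<lambda>_. 1) \<in> bp_closure unit_circle characters"
    by (rule one_in_bp_closure_characters)
  show "A \<in> sigma_sets UNIV (Collect closed)"
    using assms by (simp add: borel_eq_closed)
  show "indicator C \<in> bp_closure unit_circle characters" if "C \<in> Collect closed" for C :: "complex set"
  proof (cases "C = {}")
    case True
    have "indicator C = (\<lambda>_. 0 :: complex)" by (rule ext) (simp add: True)
    then show ?thesis using bp_closure.scale[OF one, of 0] by simp
  next
    case False
    let ?f = "\<lambda>n z. max 0 (1 - real n * infdist z C)"
    show ?thesis
    proof (rule bp_closure.limit[where f = "\<lambda>n z. complex_of_real (?f n z)" and K = 1])
      show "(\<lambda>z. complex_of_real (?f n z)) \<in> bp_closure unit_circle characters" for n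
        by (rule continuous_in_bp_closure) (intro continuous_intros)
      show "norm (complex_of_real (?f n z)) \<le> 1" for n z
        by (simp add: infdist_nonneg)
      show "(\<lambda>n. complex_of_real (?f n z)) \<longlonglongrightarrow> indicator C z" for z
      proof (cases "z \<in> C")
        case True
        then show ?thesis by simp
      next
        case z: False
        then have pos: "infdist z C > 0"
          using that False in_closed_iff_infdist_zero[of C z] infdist_nonneg[of z C]
          by (simp add: less_le)
        obtain N where N: "1 < real N * infdist z C"
          using reals_Archimedean3[OF pos] by blast
        have "?f n z = 0" if "n \<ge> N" for n
        proof -
          have "real N * infdist z C \<le> real n * infdist z C"
            using that pos by (intro mult_right_mono) auto
          then show ?thesis using N by simp
        qed
        then have "eventually (\<lambda>n. complex_of_real (?f n z) = indicator C z) sequentially"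
          using z by (auto simp: eventually_sequentially intro!: exI[of _ N])
        then show ?thesis by (rule tendsto_eventually)
      qed
    qed
  qed
qed (auto simp: Int_stable_def characters_bounded)

section \<open>Invariant measures and averages along Folner sequences\<close>

definition mean_over :: "nat set \<Rightarrow> (nat \<Rightarrow> 'b) \<Rightarrow> 'b::real_normed_field" where
  "mean_over F a = (\<Sum>j\<in>F. a j) / of_nat (card F)"

lemma mean_over_add: "mean_over F (\<lambda>j. a j + b j) = mean_over F a + mean_over F b"
  by (simp add: mean_over_def sum.distrib add_divide_distrib)

lemma mean_over_diff: "mean_over F (\<lambda>j. a j - b j) = mean_over F a - mean_over F b"
  by (simp add: mean_over_def sum_subtractf diff_divide_distrib)

lemma mean_over_cmult: "mean_over F (\<lambda>j. c * a j) = c * mean_over F a"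
  by (simp add: mean_over_def sum_distrib_left)

lemma mean_over_const: "finite F \<Longrightarrow> F \<noteq> {} \<Longrightarrow> mean_over F (\<lambda>_. c) = c"
  by (simp add: mean_over_def)

lemma norm_mean_over_le:
  assumes "finite F" "F \<noteq> {}"
  shows "norm (mean_over F a) \<le> mean_over F (\<lambda>j. norm (a j))"
  using norm_sum[of a F] by (simp add: mean_over_def norm_divide divide_right_mono)

lemma mean_over_mono:
  fixes a b :: "nat \<Rightarrow> real"
  shows "(\<And>j. j \<in> F \<Longrightarrow> a j \<le> b j) \<Longrightarrow> mean_over F a \<le> mean_over F b"
  by (simp add: mean_over_def sum_mono divide_right_mono)

lemma mean_over_bound:
  assumes "finite F" "F \<noteq> {}" "\<And>j. j \<in> F \<Longrightarrow> norm (a j) \<le> K"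
  shows "norm (mean_over F a) \<le> K"
proof -
  have "mean_over F (\<lambda>j. norm (a j)) \<le> mean_over F (\<lambda>_. K)"
    by (rule mean_over_mono) (rule assms)
  then show ?thesis
    using norm_mean_over_le[OF assms(1,2), of a] mean_over_const[OF assms(1,2), of K] by linarith
qed

lemma power2_mean_over_le:
  fixes a :: "nat \<Rightarrow> real"
  assumes "finite F" "F \<noteq> {}"
  shows "(mean_over F a)\<^sup>2 \<le> mean_over F (\<lambda>j. (a j)\<^sup>2)"
proof -
  have "real (card F) > 0" using assms by (simp add: card_gt_0_iff)
  then show ?thesis
    using sum_squared_le_sum_of_squares[of a F]
    by (simp add: mean_over_def power_divide divide_simps power2_eq_square)
qed

lemma folner_sequenceD:
  assumes "folner_sequence F"
  shows "finite (F n)" "F n \<noteq> {}"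
  using assms by (auto simp: folner_sequence_def)

text \<open>After shifting the index, the two sums differ only in the terms indexed by the symmetric difference of
\<open>F\<close> and \<open>F + 1\<close>.\<close>

lemma folner_mean_over_shift:
  fixes a :: "nat \<Rightarrow> 'b::real_normed_field"
  assumes "finite F" "F \<noteq> {}" and K: "\<And>j. norm (a j) \<le> K"
  shows "norm (mean_over F (\<lambda>j. a (Suc j)) - mean_over F a)
    \<le> K * (real (card (sym_diff ((\<lambda>x. x + 1) ` F) F)) / real (card F))"
proof -
  let ?S = "(\<lambda>x. x + 1) ` F"
  have "(\<Sum>j\<in>F. a (Suc j)) = sum a ?S"
    by (subst sum.reindex) auto
  moreover have "sum a ?S = sum a (?S - F) + sum a (?S \<inter> F)" "sum a F = sum a (F - ?S) + sum a (?S \<inter> F)"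
    using assms(1) sum.Int_Diff[of ?S a F] sum.Int_Diff[of F a ?S] by (auto simp: Int_commute add.commute)
  ultimately have diff: "(\<Sum>j\<in>F. a (Suc j)) - sum a F = sum a (?S - F) - sum a (F - ?S)"
    by simp
  have "norm (sum a (?S - F)) \<le> K * card (?S - F)" "norm (sum a (F - ?S)) \<le> K * card (F - ?S)"
    using sum_norm_bound[of "?S - F" a K] sum_norm_bound[of "F - ?S" a K] K by (simp_all add: mult.commute)
  moreover have "card (sym_diff ?S F) = card (?S - F) + card (F - ?S)"
    using assms(1) by (intro card_Un_disjoint) auto
  ultimately have "norm ((\<Sum>j\<in>F. a (Suc j)) - sum a F) \<le> K * card (sym_diff ?S F)"
    unfolding diff using norm_triangle_ineq4[of "sum a (?S - F)" "sum a (F - ?S)"] by (simp add: algebra_simps)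
  then show ?thesis
    by (simp add: mean_over_def norm_divide divide_right_mono flip: diff_divide_distrib)
qed

lemma folner_shift_null:
  assumes "folner_sequence F"
  shows "(\<lambda>n. K * (real (card (sym_diff ((\<lambda>x. x + 1) ` F n) (F n))) / real (card (F n)))) \<longlonglongrightarrow> 0"
  using assms unfolding folner_sequence_def by (intro tendsto_mult_right_zero) blast

lemma folner_lessThan: "folner_sequence (\<lambda>n. {..<Suc n})"
  unfolding folner_sequence_def
proof (intro conjI allI)
  fix m :: nat
  have "card (sym_diff ((\<lambda>x. x + m) ` {..<Suc n}) {..<Suc n}) \<le> 2 * m" for n
  proof -
    have "sym_diff ((\<lambda>x. x + m) ` {..<Suc n}) {..<Suc n} \<subseteq> {..<m} \<union> {Suc n..<Suc n + m}"
    proof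
      fix y assume y: "y \<in> sym_diff ((\<lambda>x. x + m) ` {..<Suc n}) {..<Suc n}"
      show "y \<in> {..<m} \<union> {Suc n..<Suc n + m}"
      proof (cases "y < m")
        case False
        then have "y = (y - m) + m" by simp
        then have "y - m < Suc n \<Longrightarrow> y \<in> (\<lambda>x. x + m) ` {..<Suc n}" by blast
        with y False show ?thesis by fastforce
      qed simp
    qed
    then have "card (sym_diff ((\<lambda>x. x + m) ` {..<Suc n}) {..<Suc n}) \<le> card ({..<m} \<union> {Suc n..<Suc n + m})"
      by (intro card_mono) auto
    also have "\<dots> \<le> 2 * m" using card_Un_le[of "{..<m}" "{Suc n..<Suc n + m}"] by simp
    finally show ?thesis .
  qed
  then have le: "real (card (sym_diff ((\<lambda>x. x + m) ` {..<Suc n}) {..<Suc n})) \<le> 2 * m" for n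
    by (metis of_nat_le_iff of_nat_mult of_nat_numeral)
  have lim: "(\<lambda>n. 2 * real m * inverse (real (Suc n))) \<longlonglongrightarrow> 0"
    by (rule tendsto_mult_right_zero[OF LIMSEQ_inverse_real_of_nat])
  show "(\<lambda>n. real (card (sym_diff ((\<lambda>x. x + m) ` {..<Suc n}) {..<Suc n})) / real (card {..<Suc n})) \<longlonglongrightarrow> 0"
  proof (rule Lim_null_comparison[OF always_eventually lim], intro allI)
    fix n
    have "real (card (sym_diff ((\<lambda>x. x + m) ` {..<Suc n}) {..<Suc n})) / real (Suc n) \<le> 2 * real m / real (Suc n)"
      using divide_right_mono[OF le, of "real (Suc n)" n] by simp
    then show "norm (real (card (sym_diff ((\<lambda>x. x + m) ` {..<Suc n}) {..<Suc n})) / real (card {..<Suc n}))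
        \<le> 2 * real m * inverse (real (Suc n))"
      by (simp add: divide_inverse)
  qed
qed auto

lemma invariant_measurable: "invariant_measure T M \<Longrightarrow> T \<in> M \<rightarrow>\<^sub>M M"
  by (simp add: invariant_measure_def)

lemma invariant_distr:
  assumes "invariant_measure T M"
  shows "distr M M T = M"
  by (rule measure_eqI) (use assms in \<open>auto simp: invariant_measure_def emeasure_distr\<close>)

lemma distr_invariant:
  assumes "T \<in> M \<rightarrow>\<^sub>M M" "distr M M T = M"
  shows "invariant_measure T M"
  unfolding invariant_measure_def using assms by (metis emeasure_distr)

lemma invariant_funpow:
  assumes "invariant_measure T M"
  shows "invariant_measure (T ^^ j) M"
proof (induction j)
  case (Suc j)
  note meas = invariant_measurable[OF assms] invariant_measurable[OF Suc]
  have "distr M M (T \<circ> T ^^ j) = M"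
    using distr_distr[OF meas] invariant_distr[OF assms] invariant_distr[OF Suc] by simp
  then show ?case
    by (intro distr_invariant) (use measurable_comp[OF meas(2,1)] in \<open>simp_all only: funpow.simps\<close>)
qed (auto simp: invariant_measure_def)

lemma invariant_integral:
  fixes f :: "'a \<Rightarrow> 'b::{banach, second_countable_topology}"
  assumes "invariant_measure T M" "f \<in> borel_measurable M"
  shows "(LINT x|M. f (T x)) = (LINT x|M. f x)"
  using integral_distr[OF invariant_measurable[OF assms(1)] assms(2)]
  by (simp add: invariant_distr[OF assms(1)])

lemma invariant_AE:
  assumes "invariant_measure T M" "AE x in M. P x"
  shows "AE x in M. P (T x)"
  using AE_distrD[OF invariant_measurable[OF assms(1)]] assms(2)
  unfolding invariant_distr[OF assms(1)] by blast

lemma ergodic_invariant: "ergodic_measure T M \<Longrightarrow> invariant_measure T M"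
  by (simp add: ergodic_measure_def)

section \<open>The mean ergodic theorem along Folner sequences\<close>

text \<open>The set of points whose orbit visits \<open>A\<close> infinitely often is strictly invariant and agrees almost
everywhere with an almost invariant \<open>A\<close>.\<close>

lemma ergodic_AE_invariant_set:
  assumes "prob_space M" and erg: "ergodic_measure T M" and A: "A \<in> sets M"
    and inv: "AE x in M. T x \<in> A \<longleftrightarrow> x \<in> A"
  shows "measure M A = 0 \<or> measure M A = 1"
proof -
  interpret prob_space M by fact
  note T = ergodic_invariant[OF erg]
  have meas: "(T ^^ k) -` A \<inter> space M \<in> sets M" for k
    using measurable_sets[OF invariant_measurable[OF invariant_funpow[OF T]] A] .
  define B where "B = (\<Inter>n. \<Union>k\<in>{n..}. (T ^^ k) -` A \<inter> space M)"
  have B: "B \<in> sets M"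
    unfolding B_def using meas by (intro sets.countable_INT' sets.countable_UN' image_subsetI) auto
  have memB: "x \<in> B \<longleftrightarrow> x \<in> space M \<and> (\<forall>n. \<exists>k\<ge>n. (T ^^ k) x \<in> A)" for x
    unfolding B_def by auto
  have "T -` B \<inter> space M = B"
  proof (intro set_eqI)
    fix x
    have "(\<forall>n. \<exists>k\<ge>n. (T ^^ Suc k) x \<in> A) \<longleftrightarrow> (\<forall>n. \<exists>k\<ge>n. (T ^^ k) x \<in> A)"
      by (metis Suc_le_D Suc_le_mono le_SucI)
    moreover have "x \<in> space M \<Longrightarrow> T x \<in> space M"
      using measurable_space[OF invariant_measurable[OF T]] .
    ultimately show "x \<in> T -` B \<inter> space M \<longleftrightarrow> x \<in> B"
      by (auto simp: memB funpow_Suc_right simp del: funpow.simps)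
  qed
  then have "(measure M B)\<^sup>2 = measure M B"
    using erg B by (auto simp: ergodic_measure_def)
  then have "measure M B = 0 \<or> measure M B = 1"
    by (auto simp: power2_eq_square)
  moreover have "measure M A = measure M B"
  proof (rule finite_measure_eq_AE[OF _ A B])
    have "AE x in M. (T ^^ k) x \<in> A \<longleftrightarrow> x \<in> A" for k
    proof (induction k)
      case (Suc k)
      from invariant_AE[OF invariant_funpow[OF T] inv, of k] Suc show ?case
        by eventually_elim simp
    qed simp
    then have "AE x in M. \<forall>k. (T ^^ k) x \<in> A \<longleftrightarrow> x \<in> A"
      by (simp add: AE_all_countable)
    then show "AE x in M. x \<in> A \<longleftrightarrow> x \<in> B"
      using AE_space by eventually_elim (auto simp: memB)
  qed
  ultimately show ?thesis by simp
qed

text \<open>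
The set \<open>{g > 0}\<close> is null or of full measure, so \<open>g\<close> has constant sign almost everywhere.
\<close>

lemma ergodic_AE_invariant_function:
  fixes g :: "'a \<Rightarrow> real"
  assumes "prob_space M" and erg: "ergodic_measure T M" and g: "integrable M g"
    and inv: "AE x in M. g (T x) = g x" and zero: "(LINT x|M. g x) = 0"
  shows "AE x in M. g x = 0"
proof -
  interpret prob_space M by fact
  define A where "A = {x \<in> space M. g x > 0}"
  have A: "A \<in> sets M" unfolding A_def using g by measurable
  have "AE x in M. T x \<in> A \<longleftrightarrow> x \<in> A"
    using inv AE_space
  proof eventually_elim
    case (elim x)
    then show ?case
      using measurable_space[OF invariant_measurable[OF ergodic_invariant[OF erg]], of x]
      by (auto simp: A_def)
  qed
  then consider "measure M A = 0" | "measure M A = 1"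
    using ergodic_AE_invariant_set[OF assms(1) erg A] by blast
  then show ?thesis
  proof cases
    case 1
    then have "AE x in M. x \<notin> A" using prob_eq_0[OF A] by simp
    then have "AE x in M. 0 \<le> - g x"
      using AE_space by eventually_elim (auto simp: A_def)
    then show ?thesis
      using integral_nonneg_eq_0_iff_AE[of M "\<lambda>x. - g x"] g zero by simp
  next
    case 2
    then have "AE x in M. x \<in> A" using prob_eq_1[OF A] by simp
    then have "AE x in M. 0 \<le> g x"
      by eventually_elim (auto simp: A_def)
    then show ?thesis
      using integral_nonneg_eq_0_iff_AE[of M g] g zero by simp
  qed
qed

lemma bounded_real_integrable:
  fixes f :: "'a \<Rightarrow> real"
  assumes "prob_space M" "f \<in> borel_measurable M" "\<And>x. x \<in> space M \<Longrightarrow> \<bar>f x\<bar> \<le> K"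
  shows "integrable M f" "integrable M (\<lambda>x. (f x)\<^sup>2)"
proof -
  interpret prob_space M by fact
  show "integrable M f"
    by (rule integrable_const_bound[where B = K]) (use assms in auto)
  have "(f x)\<^sup>2 \<le> K\<^sup>2" if "x \<in> space M" for x
    using power_mono[OF assms(3)[OF that], of 2] by simp
  then show "integrable M (\<lambda>x. (f x)\<^sup>2)"
    by (intro integrable_const_bound[where B = "K\<^sup>2"] AE_I2) (use assms(2) in auto)
qed

lemma L1_le_L2:
  fixes f :: "'a \<Rightarrow> real"
  assumes "prob_space M" "f \<in> borel_measurable M" "\<And>x. x \<in> space M \<Longrightarrow> \<bar>f x\<bar> \<le> K"
  shows "(LINT x|M. \<bar>f x\<bar>) \<le> sqrt (LINT x|M. (f x)\<^sup>2)"
proof -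
  interpret prob_space M by fact
  have "variance (\<lambda>x. \<bar>f x\<bar>) = (LINT x|M. (f x)\<^sup>2) - (LINT x|M. \<bar>f x\<bar>)\<^sup>2"
    using variance_eq[of "\<lambda>x. \<bar>f x\<bar>"] bounded_real_integrable[OF assms] by simp
  then have "(LINT x|M. \<bar>f x\<bar>)\<^sup>2 \<le> (LINT x|M. (f x)\<^sup>2)"
    using variance_positive[of "\<lambda>x. \<bar>f x\<bar>"] by linarith
  then show ?thesis by (rule real_le_rsqrt)
qed

text \<open>The \<open>L\<^sup>2\<close> bounds dominate \<open>L\<^sup>1\<close> norms with a finite sum, and the sum of the absolute values is then
integrable. This replaces completeness of \<open>L\<^sup>2\<close>.\<close>

lemma AE_convergent_of_L2_steps:
  fixes d :: "nat \<Rightarrow> 'a \<Rightarrow> real"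
  assumes "prob_space M" and d: "\<And>k. d k \<in> borel_measurable M"
    and K: "\<And>k x. x \<in> space M \<Longrightarrow> \<bar>d k x\<bar> \<le> K"
    and small: "\<And>k. (LINT x|M. (d k x)\<^sup>2) \<le> (2 * (1/2) ^ k)\<^sup>2"
  shows "AE x in M. summable (\<lambda>k. \<bar>d k x\<bar>)"
proof -
  have L1: "(LINT x|M. \<bar>d k x\<bar>) \<le> 2 * (1/2) ^ k" for k
  proof -
    have "sqrt (LINT x|M. (d k x)\<^sup>2) \<le> 2 * (1/2) ^ k"
      using small by (intro real_le_lsqrt) auto
    then show ?thesis using L1_le_L2[OF assms(1) d K, of k] by simp
  qed
  have nn: "(\<integral>\<^sup>+x. ennreal \<bar>d k x\<bar> \<partial>M) \<le> ennreal (2 * (1/2) ^ k)" for k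
    using bounded_real_integrable(1)[OF assms(1) d K] L1[of k]
    by (subst nn_integral_eq_integral) (auto intro: ennreal_leI)
  have "(\<integral>\<^sup>+x. (\<Sum>k. ennreal \<bar>d k x\<bar>) \<partial>M) = (\<Sum>k. \<integral>\<^sup>+x. ennreal \<bar>d k x\<bar> \<partial>M)"
    using d by (intro nn_integral_suminf) auto
  also have "\<dots> \<le> (\<Sum>k. ennreal (2 * (1/2) ^ k))"
    by (intro suminf_le nn) auto
  also have "\<dots> = ennreal (\<Sum>k. 2 * (1/2) ^ k)"
    by (intro suminf_ennreal2 summable_mult summable_geometric) auto
  finally have "(\<integral>\<^sup>+x. (\<Sum>k. ennreal \<bar>d k x\<bar>) \<partial>M) \<noteq> \<infinity>"
    by (auto simp: top_unique)
  then have "AE x in M. (\<Sum>k. ennreal \<bar>d k x\<bar>) \<noteq> \<infinity>"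
    using d by (intro nn_integral_PInf_AE) auto
  then show ?thesis
    by eventually_elim (auto intro: summable_suminf_not_top)
qed

text \<open>Midpoints suffice in place of all convex combinations, since the parallelogram law involves nothing else.\<close>

inductive_set orbit_hull :: "('a \<Rightarrow> 'a) \<Rightarrow> ('a \<Rightarrow> real) \<Rightarrow> ('a \<Rightarrow> real) set"
  for T :: "'a \<Rightarrow> 'a" and f :: "'a \<Rightarrow> real" where
  base: "f \<in> orbit_hull T f"
| shift: "h \<in> orbit_hull T f \<Longrightarrow> (\<lambda>x. h (T x)) \<in> orbit_hull T f"
| midpoint: "h \<in> orbit_hull T f \<Longrightarrow> k \<in> orbit_hull T f \<Longrightarrow> (\<lambda>x. (h x + k x) / 2) \<in> orbit_hull T f"

lemma orbit_hull_measurable_bounded: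
  assumes T: "T \<in> M \<rightarrow>\<^sub>M M" and f: "f \<in> borel_measurable M"
    and K: "\<And>x. x \<in> space M \<Longrightarrow> \<bar>f x\<bar> \<le> K" and h: "h \<in> orbit_hull T f"
  shows "h \<in> borel_measurable M" "\<And>x. x \<in> space M \<Longrightarrow> \<bar>h x\<bar> \<le> K"
proof -
  have "h \<in> borel_measurable M \<and> (\<forall>x\<in>space M. \<bar>h x\<bar> \<le> K)"
    using h
  proof induction
    case base
    then show ?case using f K by blast
  next
    case (shift h)
    then show ?case using T measurable_space[OF T] by (auto intro: measurable_compose[OF T])
  next
    case (midpoint h k)
    have "\<bar>(h x + k x) / 2\<bar> \<le> K" if "x \<in> space M" for x
      using that midpoint.IH by (auto simp: abs_le_iff field_simps) (smt (verit))+
    then show ?case using midpoint.IH by auto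
  qed
  then show "h \<in> borel_measurable M" "\<And>x. x \<in> space M \<Longrightarrow> \<bar>h x\<bar> \<le> K" by auto
qed

lemma orbit_hull_integral:
  assumes "prob_space M" and T: "invariant_measure T M" and f: "f \<in> borel_measurable M"
    and K: "\<And>x. x \<in> space M \<Longrightarrow> \<bar>f x\<bar> \<le> K" and h: "h \<in> orbit_hull T f"
  shows "(LINT x|M. h x) = (LINT x|M. f x)"
  using h
proof induction
  case (shift h)
  then show ?case
    using invariant_integral[OF T] orbit_hull_measurable_bounded(1)[OF invariant_measurable[OF T] f K]
    by metis
next
  case (midpoint h k)
  have "integrable M h" "integrable M k"
    using midpoint.hyps orbit_hull_measurable_bounded[OF invariant_measurable[OF T] f K]
    by (auto intro!: bounded_real_integrable(1)[OF assms(1)])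
  then show ?case using midpoint.IH by simp
qed simp

text \<open>Induction on the hull: passing from \<open>h\<close> to \<open>h \<circ> T\<close> shifts the averaged sequence by one, which costs a
Folner error, and midpoints average the errors.\<close>

lemma orbit_hull_mean_over:
  assumes F: "folner_sequence F" and T: "T \<in> M \<rightarrow>\<^sub>M M" and f: "f \<in> borel_measurable M"
    and K: "\<And>x. x \<in> space M \<Longrightarrow> \<bar>f x\<bar> \<le> K" and h: "h \<in> orbit_hull T f"
  shows "\<exists>\<delta>. \<delta> \<longlonglongrightarrow> 0 \<and> (\<forall>n. \<forall>x\<in>space M.
    \<bar>mean_over (F n) (\<lambda>j. f ((T ^^ j) x)) - mean_over (F n) (\<lambda>j. h ((T ^^ j) x))\<bar> \<le> \<delta> n)"
  using h
proof induction
  case base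
  show ?case by (rule exI[of _ "\<lambda>_. 0"]) simp
next
  case (shift h)
  then obtain \<delta> where \<delta>: "\<delta> \<longlonglongrightarrow> 0" "\<And>n x. x \<in> space M \<Longrightarrow>
      \<bar>mean_over (F n) (\<lambda>j. f ((T ^^ j) x)) - mean_over (F n) (\<lambda>j. h ((T ^^ j) x))\<bar> \<le> \<delta> n" by blast
  let ?\<epsilon> = "\<lambda>n. K * (real (card (sym_diff ((\<lambda>x. x + 1) ` F n) (F n))) / real (card (F n)))"
  have "\<bar>mean_over (F n) (\<lambda>j. f ((T ^^ j) x)) - mean_over (F n) (\<lambda>j. h (T ((T ^^ j) x)))\<bar> \<le> \<delta> n + ?\<epsilon> n"
    if x: "x \<in> space M" for n x
  proof -
    have "(T ^^ j) x \<in> space M" for j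
      by (rule measurable_space[OF measurable_compose_n[OF T] x])
    then have "norm (h ((T ^^ j) x)) \<le> K" for j
      using orbit_hull_measurable_bounded(2)[OF T f K shift.hyps] by simp
    then have "norm (mean_over (F n) (\<lambda>j. h ((T ^^ Suc j) x)) - mean_over (F n) (\<lambda>j. h ((T ^^ j) x)))
        \<le> ?\<epsilon> n"
      by (intro folner_mean_over_shift folner_sequenceD[OF F])
    then show ?thesis using \<delta>(2)[OF x, of n] by simp
  qed
  moreover have "(\<lambda>n. \<delta> n + ?\<epsilon> n) \<longlonglongrightarrow> 0"
    using tendsto_add[OF \<delta>(1) folner_shift_null[OF F, of K]] by simp
  ultimately show ?case by (intro exI[of _ "\<lambda>n. \<delta> n + ?\<epsilon> n"]) blast
next
  case (midpoint h k)
  then obtain \<delta> \<epsilon> where \<delta>: "\<delta> \<longlonglongrightarrow> 0" "\<And>n x. x \<in> space M \<Longrightarrow>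
      \<bar>mean_over (F n) (\<lambda>j. f ((T ^^ j) x)) - mean_over (F n) (\<lambda>j. h ((T ^^ j) x))\<bar> \<le> \<delta> n"
    and \<epsilon>: "\<epsilon> \<longlonglongrightarrow> 0" "\<And>n x. x \<in> space M \<Longrightarrow>
      \<bar>mean_over (F n) (\<lambda>j. f ((T ^^ j) x)) - mean_over (F n) (\<lambda>j. k ((T ^^ j) x))\<bar> \<le> \<epsilon> n" by blast
  have "\<bar>mean_over (F n) (\<lambda>j. f ((T ^^ j) x)) - mean_over (F n) (\<lambda>j. (h ((T ^^ j) x) + k ((T ^^ j) x)) / 2)\<bar>
      \<le> \<delta> n + \<epsilon> n" if x: "x \<in> space M" for n x
  proof -
    have "mean_over (F n) (\<lambda>j. (h ((T ^^ j) x) + k ((T ^^ j) x)) / 2) =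
      (mean_over (F n) (\<lambda>j. h ((T ^^ j) x)) + mean_over (F n) (\<lambda>j. k ((T ^^ j) x))) / 2"
      using mean_over_cmult[of "F n" "1/2" "\<lambda>j. h ((T ^^ j) x) + k ((T ^^ j) x)"]
      by (simp add: mean_over_add)
    then show ?thesis using \<delta>(2)[OF x, of n] \<epsilon>(2)[OF x, of n] by (simp add: abs_if split: if_splits)
  qed
  moreover have "(\<lambda>n. \<delta> n + \<epsilon> n) \<longlonglongrightarrow> 0"
    using tendsto_add[OF \<delta>(1) \<epsilon>(1)] by simp
  ultimately show ?case by (intro exI[of _ "\<lambda>n. \<delta> n + \<epsilon> n"]) blast
qed


text \<open>Let \<open>m\<close> be the infimum of \<open>\<integral> h\<^sup>2\<close> over the hull. If \<open>u\<close>, \<open>v\<close> in the hull have energy at most \<open>m + r\<close>, then,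
their midpoint having energy at least \<open>m\<close>, the parallelogram law gives \<open>\<integral> (u - v)\<^sup>2 \<le> 4 r\<close>. Applied to
consecutive terms of a minimising sequence, and to \<open>h\<close> and \<open>h \<circ> T\<close>, this yields an almost everywhere
limit that is invariant. It has mean zero, so it vanishes by ergodicity, and \<open>m = 0\<close>.\<close>

lemma orbit_hull_small:
  fixes f :: "'a \<Rightarrow> real"
  assumes M: "prob_space M" and erg: "ergodic_measure T M" and f: "f \<in> borel_measurable M"
    and K: "\<And>x. x \<in> space M \<Longrightarrow> \<bar>f x\<bar> \<le> K" and zero: "(LINT x|M. f x) = 0" and "e > 0"
  shows "\<exists>h\<in>orbit_hull T f. (LINT x|M. (h x)\<^sup>2) < e"
proof -
  interpret prob_space M by fact
  note T = ergodic_invariant[OF erg]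
  have hull: "h \<in> borel_measurable M" "x \<in> space M \<Longrightarrow> \<bar>h x\<bar> \<le> K" if "h \<in> orbit_hull T f" for h x
    using orbit_hull_measurable_bounded[OF invariant_measurable[OF T] f K that] by auto
  define E where "E h = (LINT x|M. (h x)\<^sup>2)" for h :: "'a \<Rightarrow> real"
  define m where "m = Inf (E ` orbit_hull T f)"
  have bdd: "bdd_below (E ` orbit_hull T f)"
    by (rule bdd_belowI2[of _ 0]) (simp add: E_def)
  have m_le: "m \<le> E h" if "h \<in> orbit_hull T f" for h
    unfolding m_def by (rule cINF_lower[OF bdd that])
  have dist: "(LINT x|M. (u x - v x)\<^sup>2) \<le> 4 * r"
    if u: "u \<in> orbit_hull T f" and v: "v \<in> orbit_hull T f" and "E u \<le> m + r" "E v \<le> m + r" for u v r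
  proof -
    let ?w = "\<lambda>x. (u x + v x) / 2"
    have w: "?w \<in> orbit_hull T f" by (rule orbit_hull.midpoint[OF u v])
    have sq: "integrable M (\<lambda>x. (w x)\<^sup>2)" if "w \<in> orbit_hull T f" for w
      by (rule bounded_real_integrable(2)[OF M hull(1)[OF that]]) (rule hull(2)[OF that])
    have "(LINT x|M. (u x - v x)\<^sup>2) = (LINT x|M. 2 * (u x)\<^sup>2 + 2 * (v x)\<^sup>2 - 4 * (?w x)\<^sup>2)"
      by (rule Bochner_Integration.integral_cong) (auto simp: power2_eq_square field_simps)
    also have "\<dots> = 2 * E u + 2 * E v - 4 * E ?w"
      unfolding E_def using sq[OF u] sq[OF v] sq[OF w]
      by (simp add: Bochner_Integration.integral_diff Bochner_Integration.integral_add)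
    also have "\<dots> \<le> 4 * r" using m_le[OF w] that(3,4) by linarith
    finally show ?thesis .
  qed
  \<comment> \<open>The rate \<open>(1/4)\<^sup>k\<close> makes consecutive distances at most \<open>2 (1/2)\<^sup>k\<close>, which is summable.\<close>
  have "\<exists>h\<in>orbit_hull T f. E h < m + (1/4) ^ k" for k :: nat
    using cInf_lessD[of "E ` orbit_hull T f" "m + (1/4) ^ k"] orbit_hull.base[of f T]
    unfolding m_def[symmetric] by fastforce
  then have "\<exists>h. \<forall>k. h k \<in> orbit_hull T f \<and> E (h k) < m + (1/4) ^ k"
    by (intro choice) blast
  then obtain h where h: "\<And>k. h k \<in> orbit_hull T f" and Eh: "\<And>k. E (h k) < m + (1/4) ^ k"
    by blast
  have hm: "h k \<in> borel_measurable M" and hK: "x \<in> space M \<Longrightarrow> \<bar>h k x\<bar> \<le> K" for k x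
    using hull h by blast+
  have K0: "0 \<le> K"
    using not_empty K by (meson abs_ge_zero ex_in_conv order_trans)
  have quarter: "(2 * (1/2) ^ k)\<^sup>2 = 4 * (1/4::real) ^ k" for k
    by (simp add: power_mult_distrib power2_eq_square flip: power_mult_distrib)
  have "AE x in M. summable (\<lambda>k. \<bar>h (Suc k) x - h k x\<bar>)"
  proof (rule AE_convergent_of_L2_steps[OF M])
    show "(\<lambda>x. h (Suc k) x - h k x) \<in> borel_measurable M" for k
      using hm by simp
    show "\<bar>h (Suc k) x - h k x\<bar> \<le> 2 * K" if "x \<in> space M" for k x
      using hK[OF that, of k] hK[OF that, of "Suc k"] by linarith
    show "(LINT x|M. (h (Suc k) x - h k x)\<^sup>2) \<le> (2 * (1/2) ^ k)\<^sup>2" for k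
    proof -
      have "(1/4::real) ^ Suc k \<le> (1/4) ^ k" by simp
      then show ?thesis
        unfolding quarter using Eh[of k] Eh[of "Suc k"] by (intro dist h) linarith+
    qed
  qed
  moreover have "summable (\<lambda>k. \<bar>h (Suc k) x - h k x\<bar>) \<Longrightarrow> convergent (\<lambda>k. h k x)" for x
  proof -
    assume "summable (\<lambda>k. \<bar>h (Suc k) x - h k x\<bar>)"
    then have "summable (\<lambda>k. h (Suc k) x - h k x)" by (rule summable_rabs_cancel)
    then have "convergent (\<lambda>n. \<Sum>k<n. h (Suc k) x - h k x)"
      by (simp add: summable_iff_convergent)
    then have "convergent (\<lambda>n. h n x - h 0 x)" 
      by (simp only: sum_lessThan_telescope[of "\<lambda>k. h k x"])
    then have "convergent (\<lambda>n. (h n x - h 0 x) + h 0 x)" by (intro convergent_add convergent_const)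
    then show "convergent (\<lambda>k. h k x)" by simp
  qed
  ultimately have conv: "AE x in M. convergent (\<lambda>k. h k x)" by auto
  have "AE x in M. summable (\<lambda>k. \<bar>h k (T x) - h k x\<bar>)"
  proof (rule AE_convergent_of_L2_steps[OF M])
    note hT = orbit_hull.shift[OF h]
    show "(\<lambda>x. h k (T x) - h k x) \<in> borel_measurable M" for k
      using hm hull(1)[OF hT] by simp
    show "\<bar>h k (T x) - h k x\<bar> \<le> 2 * K" if "x \<in> space M" for k x
      using hK[OF that, of k] hull(2)[OF hT[of k] that] by linarith
    show "(LINT x|M. (h k (T x) - h k x)\<^sup>2) \<le> (2 * (1/2) ^ k)\<^sup>2" for k
    proof -
      have "E (\<lambda>x. h k (T x)) = E (h k)"
        unfolding E_def using invariant_integral[OF T, of "\<lambda>x. (h k x)\<^sup>2"] hm by simp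
      then show ?thesis
        unfolding quarter using Eh[of k] by (intro dist h hT) linarith+
    qed
  qed
  then have shift: "AE x in M. (\<lambda>k. h k (T x) - h k x) \<longlonglongrightarrow> 0"
    by eventually_elim (auto dest: summable_LIMSEQ_zero summable_rabs_cancel)
  define g where "g x = lim (\<lambda>k. h k x)" for x
  have g: "g \<in> borel_measurable M" unfolding g_def using hm by measurable
  have lim: "AE x in M. (\<lambda>k. h k x) \<longlonglongrightarrow> g x"
    using conv by eventually_elim (simp add: g_def convergent_LIMSEQ_iff)
  have inv: "AE x in M. g (T x) = g x"
    using lim invariant_AE[OF T lim] shift
  proof eventually_elim
    case (elim x)
    have "g (T x) - g x = 0"
      by (rule LIMSEQ_unique[OF tendsto_diff[OF elim(2,1)] elim(3)])
    then show ?case by simp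
  qed
  have "integrable M g"
    by (rule integrable_dominated_convergence[where w = "\<lambda>_. K" and s = h])
      (use g hm hK lim in auto)
  moreover have "(\<lambda>k. LINT x|M. h k x) \<longlonglongrightarrow> (LINT x|M. g x)"
    by (rule integral_dominated_convergence[where w = "\<lambda>_. K"])
      (use g hm hK lim in auto)
  then have "(LINT x|M. g x) = 0"
    using orbit_hull_integral[OF M T f K h] zero by (simp add: LIMSEQ_const_iff)
  ultimately have g0: "AE x in M. g x = 0"
    by (intro ergodic_AE_invariant_function[OF M erg] inv)
  have "(\<lambda>k. E (h k)) \<longlonglongrightarrow> (LINT x|M. 0)"
    unfolding E_def
  proof (rule integral_dominated_convergence[where w = "\<lambda>_. K\<^sup>2"])
    show "AE x in M. (\<lambda>k. (h k x)\<^sup>2) \<longlonglongrightarrow> 0"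
      using lim g0
    proof eventually_elim
      case (elim x)
      then show ?case using tendsto_power[of "\<lambda>k. h k x" 0 sequentially 2] by simp
    qed
    show "AE x in M. norm ((h k x)\<^sup>2) \<le> K\<^sup>2" for k
      using hK[of _ k] K0 by (intro AE_I2) (simp add: abs_le_square_iff[symmetric])
  qed (use hm in auto)
  then have "eventually (\<lambda>k. E (h k) < e) sequentially"
    using \<open>e > 0\<close> by (intro order_tendstoD(2)[where y = 0]) auto
  then obtain k where "E (h k) < e" by (auto simp: eventually_sequentially)
  then show ?thesis using h unfolding E_def by blast
qed

text \<open>Replace \<open>f\<close> by a hull element \<open>h\<close> of small norm: the averages of the two are uniformly close, and by
Jensen's inequality and invariance averaging does not increase \<open>\<integral> h\<^sup>2\<close>.\<close>

lemma mean_ergodic_folner: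
  fixes f :: "'a \<Rightarrow> real"
  assumes M: "prob_space M" and erg: "ergodic_measure T M" and F: "folner_sequence F"
    and f: "f \<in> borel_measurable M" and K: "\<And>x. x \<in> space M \<Longrightarrow> \<bar>f x\<bar> \<le> K"
    and zero: "(LINT x|M. f x) = 0"
  shows "(\<lambda>n. LINT x|M. (mean_over (F n) (\<lambda>j. f ((T ^^ j) x)))\<^sup>2) \<longlonglongrightarrow> 0"
proof (rule LIMSEQ_I)
  fix e :: real assume e: "e > 0"
  interpret prob_space M by fact
  note T = ergodic_invariant[OF erg]
  note Tj = measurable_compose_n[OF invariant_measurable[OF T]]
  obtain h where h: "h \<in> orbit_hull T f" and small: "(LINT x|M. (h x)\<^sup>2) < e / 4"
    using orbit_hull_small[OF M erg f K zero, of "e / 4"] e by auto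
  have hm: "h \<in> borel_measurable M" "x \<in> space M \<Longrightarrow> \<bar>h x\<bar> \<le> K" for x
    using orbit_hull_measurable_bounded[OF invariant_measurable[OF T] f K h] by auto
  obtain \<delta> where \<delta>: "\<delta> \<longlonglongrightarrow> 0" "\<And>n x. x \<in> space M \<Longrightarrow>
      \<bar>mean_over (F n) (\<lambda>j. f ((T ^^ j) x)) - mean_over (F n) (\<lambda>j. h ((T ^^ j) x))\<bar> \<le> \<delta> n"
    using orbit_hull_mean_over[OF F invariant_measurable[OF T] f K h] by blast
  have mean: "(\<lambda>x. mean_over (F n) (\<lambda>j. u ((T ^^ j) x))) \<in> borel_measurable M"
      "x \<in> space M \<Longrightarrow> \<bar>mean_over (F n) (\<lambda>j. u ((T ^^ j) x))\<bar> \<le> K"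
    if u: "u \<in> borel_measurable M" "\<And>x. x \<in> space M \<Longrightarrow> \<bar>u x\<bar> \<le> K" for u :: "'a \<Rightarrow> real" and n x
  proof -
    show "(\<lambda>x. mean_over (F n) (\<lambda>j. u ((T ^^ j) x))) \<in> borel_measurable M"
      unfolding mean_over_def
      by (intro borel_measurable_divide borel_measurable_sum measurable_compose[OF Tj u(1)]) auto
    show "\<bar>mean_over (F n) (\<lambda>j. u ((T ^^ j) x))\<bar> \<le> K" if "x \<in> space M"
      using mean_over_bound[OF folner_sequenceD[OF F], of n "\<lambda>j. u ((T ^^ j) x)" K]
        u(2)[OF measurable_space[OF Tj that]] by simp
  qed
  have bound: "(LINT x|M. (mean_over (F n) (\<lambda>j. f ((T ^^ j) x)))\<^sup>2) \<le> e / 2 + 2 * (\<delta> n)\<^sup>2" for n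
  proof -
    let ?A = "\<lambda>u x. mean_over (F n) (\<lambda>j. u ((T ^^ j) x))"
    have int: "integrable M (\<lambda>x. (h ((T ^^ j) x))\<^sup>2)" for j
      by (rule bounded_real_integrable(2)[OF M measurable_compose[OF Tj hm(1)]])
        (rule hm(2)[OF measurable_space[OF Tj]])
    have "(LINT x|M. (?A h x)\<^sup>2) \<le> (LINT x|M. mean_over (F n) (\<lambda>j. (h ((T ^^ j) x))\<^sup>2))"
      using int bounded_real_integrable(2)[OF M mean[OF hm(1,2)]] power2_mean_over_le[OF folner_sequenceD[OF F]]
      by (intro integral_mono) (auto simp: mean_over_def)
    also have "\<dots> = mean_over (F n) (\<lambda>j. LINT x|M. (h ((T ^^ j) x))\<^sup>2)"
      using int by (simp add: mean_over_def)
    also have "\<dots> = mean_over (F n) (\<lambda>j. LINT x|M. (h x)\<^sup>2)"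
      using invariant_integral[OF invariant_funpow[OF T], of "\<lambda>x. (h x)\<^sup>2"] hm(1) by simp
    also have "\<dots> < e / 4"
      using small folner_sequenceD[OF F] by (simp add: mean_over_const)
    finally have Ah: "(LINT x|M. (?A h x)\<^sup>2) < e / 4" .
    have "(LINT x|M. (?A f x)\<^sup>2) \<le> (LINT x|M. 2 * (?A h x)\<^sup>2 + 2 * (\<delta> n)\<^sup>2)"
    proof (rule integral_mono)
      show "integrable M (\<lambda>x. (?A f x)\<^sup>2)"
        by (rule bounded_real_integrable(2)[OF M mean[OF f K]])
      show "integrable M (\<lambda>x. 2 * (?A h x)\<^sup>2 + 2 * (\<delta> n)\<^sup>2)"
        using bounded_real_integrable(2)[OF M mean[OF hm(1,2)]] by simp
      show "(?A f x)\<^sup>2 \<le> 2 * (?A h x)\<^sup>2 + 2 * (\<delta> n)\<^sup>2" if "x \<in> space M" for x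
      proof -
        have "(?A f x - ?A h x)\<^sup>2 \<le> (\<delta> n)\<^sup>2"
          using power_mono[OF \<delta>(2)[OF that, of n], of 2] by simp
        moreover have "(?A f x)\<^sup>2 \<le> 2 * (?A h x)\<^sup>2 + 2 * (?A f x - ?A h x)\<^sup>2"
          using zero_le_power2[of "?A f x - 2 * ?A h x"] by (simp add: power2_eq_square algebra_simps)
        ultimately show ?thesis by linarith
      qed
    qed
    also have "\<dots> = 2 * (LINT x|M. (?A h x)\<^sup>2) + 2 * (\<delta> n)\<^sup>2"
      using bounded_real_integrable(2)[OF M mean[OF hm(1,2)]] by (simp add: prob_space)
    finally show ?thesis using Ah by linarith
  qed
  have "(\<lambda>n. e / 2 + 2 * (\<delta> n)\<^sup>2) \<longlonglongrightarrow> e / 2 + 2 * 0\<^sup>2"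
    by (intro tendsto_intros \<delta>)
  then have "eventually (\<lambda>n. e / 2 + 2 * (\<delta> n)\<^sup>2 < e) sequentially"
    by (rule order_tendstoD(2)) (use e in simp)
  then obtain N where "\<And>n. n \<ge> N \<Longrightarrow> e / 2 + 2 * (\<delta> n)\<^sup>2 < e"
    by (auto simp: eventually_sequentially)
  then show "\<exists>N. \<forall>n\<ge>N. norm ((LINT x|M. (mean_over (F n) (\<lambda>j. f ((T ^^ j) x)))\<^sup>2) - 0) < e"
    using bound by (intro exI[of _ N]) (auto intro: le_less_trans)
qed

definition correlation :: "('a \<Rightarrow> 'a) \<Rightarrow> 'a measure \<Rightarrow> ('a \<Rightarrow> complex) \<Rightarrow> ('a \<Rightarrow> complex) \<Rightarrow> nat \<Rightarrow> complex" where
  "correlation T M f g j = (LINT x|M. f ((T ^^ j) x) * g x)"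

lemma bounded_measurable_mult:
  "bounded_measurable M f \<Longrightarrow> bounded_measurable M g \<Longrightarrow> bounded_measurable M (\<lambda>x. f x * g x)"
  unfolding bounded_measurable_def norm_mult
  by (blast intro: borel_measurable_times mult_mono' norm_ge_zero)

lemma bounded_measurable_compose:
  "bounded_measurable N f \<Longrightarrow> T \<in> M \<rightarrow>\<^sub>M N \<Longrightarrow> bounded_measurable M (\<lambda>x. f (T x))"
  unfolding bounded_measurable_def by (blast intro: measurable_compose measurable_space)

lemma bounded_measurable_integrable:
  assumes "prob_space M" "bounded_measurable M f"
  shows "integrable M f"
proof -
  interpret prob_space M by fact
  show ?thesis
    using assms(2) unfolding bounded_measurable_def by (auto intro: integrable_const_bound)
qed

lemma correlation_integrable:
  assumes "prob_space M" "invariant_measure T M" "bounded_measurable M f" "bounded_measurable M g"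
  shows "integrable M (\<lambda>x. f ((T ^^ j) x) * g x)"
  using assms
  by (intro bounded_measurable_integrable bounded_measurable_mult
      bounded_measurable_compose[OF _ measurable_compose_n[OF invariant_measurable]])

lemma ergodic_correlation_real_zero:
  fixes f :: "'a \<Rightarrow> real"
  assumes M: "prob_space M" and erg: "ergodic_measure T M" and F: "folner_sequence F"
    and f: "f \<in> borel_measurable M" and K: "\<And>x. x \<in> space M \<Longrightarrow> \<bar>f x\<bar> \<le> K"
    and zero: "(LINT x|M. f x) = 0" and g: "bounded_measurable M g"
  shows "(\<lambda>n. mean_over (F n) (correlation T M (\<lambda>x. complex_of_real (f x)) g)) \<longlonglongrightarrow> 0"
proof -
  interpret prob_space M by fact
  note T = ergodic_invariant[OF erg]
  note Tj = measurable_compose_n[OF invariant_measurable[OF T]]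
  obtain L where L: "\<And>x. x \<in> space M \<Longrightarrow> norm (g x) \<le> L" and gm: "g \<in> borel_measurable M"
    using g by (auto simp: bounded_measurable_def)
  have L0: "0 \<le> L"
    using not_empty L by (meson norm_ge_zero ex_in_conv order_trans)
  let ?A = "\<lambda>n x. mean_over (F n) (\<lambda>j. f ((T ^^ j) x))"
  have Am: "?A n \<in> borel_measurable M" for n
    unfolding mean_over_def
    by (intro borel_measurable_divide borel_measurable_sum measurable_compose[OF Tj f]) auto
  have AK: "\<bar>?A n x\<bar> \<le> K" if "x \<in> space M" for n x
    using mean_over_bound[OF folner_sequenceD[OF F], of n "\<lambda>j. f ((T ^^ j) x)" K]
      K[OF measurable_space[OF Tj that]] by simp
  have fb: "bounded_measurable M (\<lambda>x. complex_of_real (f x))"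
    using f K by (auto simp: bounded_measurable_def)
  have Ab: "bounded_measurable M (\<lambda>x. complex_of_real (?A n x))" for n
    using Am AK by (auto simp: bounded_measurable_def)
  have bound: "norm (mean_over (F n) (correlation T M (\<lambda>x. complex_of_real (f x)) g))
      \<le> L * sqrt (LINT x|M. (?A n x)\<^sup>2)" for n
  proof -
    have "mean_over (F n) (correlation T M (\<lambda>x. complex_of_real (f x)) g)
        = (LINT x|M. mean_over (F n) (\<lambda>j. complex_of_real (f ((T ^^ j) x)) * g x))"
      using correlation_integrable[OF M T fb g]
      by (simp add: mean_over_def correlation_def)
    also have "\<dots> = (LINT x|M. complex_of_real (?A n x) * g x)"
      by (rule Bochner_Integration.integral_cong) (auto simp: mean_over_def sum_distrib_right)
    finally have "norm (mean_over (F n) (correlation T M (\<lambda>x. complex_of_real (f x)) g))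
        \<le> (LINT x|M. norm (complex_of_real (?A n x) * g x))"
      by simp
    also have "\<dots> \<le> (LINT x|M. L * \<bar>?A n x\<bar>)"
    proof (rule integral_mono)
      show "integrable M (\<lambda>x. norm (complex_of_real (?A n x) * g x))"
        by (intro integrable_norm bounded_measurable_integrable M bounded_measurable_mult g Ab)
      show "integrable M (\<lambda>x. L * \<bar>?A n x\<bar>)"
        using bounded_real_integrable(1)[OF M Am AK] by simp
      show "norm (complex_of_real (?A n x) * g x) \<le> L * \<bar>?A n x\<bar>" if "x \<in> space M" for x
        using mult_right_mono[OF L[OF that], of "\<bar>?A n x\<bar>"] by (simp add: norm_mult mult.commute)
    qed
    also have "\<dots> \<le> L * sqrt (LINT x|M. (?A n x)\<^sup>2)"
      using L1_le_L2[OF M Am AK, of n] L0 by (simp add: mult_left_mono)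
    finally show ?thesis .
  qed
  have "(\<lambda>n. L * sqrt (LINT x|M. (?A n x)\<^sup>2)) \<longlonglongrightarrow> L * sqrt 0"
    by (intro tendsto_intros mean_ergodic_folner[OF M erg F f K zero])
  then have "(\<lambda>n. L * sqrt (LINT x|M. (?A n x)\<^sup>2)) \<longlonglongrightarrow> 0"
    by simp
  then show ?thesis
    by (rule Lim_null_comparison[OF always_eventually[OF allI[OF bound]]])
qed

lemma ergodic_correlation:
  assumes M: "prob_space M" and erg: "ergodic_measure T M" and F: "folner_sequence F"
    and f: "bounded_measurable M f" and g: "bounded_measurable M g"
  shows "(\<lambda>n. mean_over (F n) (correlation T M f g)) \<longlonglongrightarrow> (LINT x|M. f x) * (LINT x|M. g x)"
proof -
  interpret prob_space M by fact
  note T = ergodic_invariant[OF erg]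
  obtain K where K: "\<And>x. x \<in> space M \<Longrightarrow> norm (f x) \<le> K" and fm: "f \<in> borel_measurable M"
    using f by (auto simp: bounded_measurable_def)
  have fi: "integrable M f" by (rule bounded_measurable_integrable[OF M f])
  define I where "I = (LINT x|M. f x)"
  define u where "u x = Re (f x) - Re I" for x
  define v where "v x = Im (f x) - Im I" for x
  have um: "u \<in> borel_measurable M" and vm: "v \<in> borel_measurable M"
    unfolding u_def v_def using fm by measurable
  have uK: "\<bar>u x\<bar> \<le> K + \<bar>Re I\<bar>" and vK: "\<bar>v x\<bar> \<le> K + \<bar>Im I\<bar>" if "x \<in> space M" for x
    using K[OF that] abs_Re_le_cmod[of "f x"] abs_Im_le_cmod[of "f x"] by (auto simp: u_def v_def)
  have u0: "(LINT x|M. u x) = 0" and v0: "(LINT x|M. v x) = 0"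
    using fi by (simp_all add: u_def v_def I_def prob_space)
  have ub: "bounded_measurable M (\<lambda>x. complex_of_real (u x))"
    and vb: "bounded_measurable M (\<lambda>x. complex_of_real (v x))"
    using um vm uK vK by (auto simp: bounded_measurable_def)
  have fuv: "f x = complex_of_real (u x) + \<i> * complex_of_real (v x) + I" for x
    by (simp add: u_def v_def complex_eq_iff)
  have eq: "correlation T M f g j = correlation T M (\<lambda>x. complex_of_real (u x)) g j
      + \<i> * correlation T M (\<lambda>x. complex_of_real (v x)) g j + I * (LINT x|M. g x)" for j
  proof -
    have "correlation T M f g j = (LINT x|M. complex_of_real (u ((T ^^ j) x)) * g x
        + \<i> * (complex_of_real (v ((T ^^ j) x)) * g x) + I * g x)"
      unfolding correlation_def fuv by (simp add: algebra_simps)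
    then show ?thesis
      using correlation_integrable[OF M T ub g] correlation_integrable[OF M T vb g]
        bounded_measurable_integrable[OF M g]
      by (simp add: correlation_def)
  qed
  have "mean_over (F n) (correlation T M f g) =
      mean_over (F n) (correlation T M (\<lambda>x. complex_of_real (u x)) g)
      + \<i> * mean_over (F n) (correlation T M (\<lambda>x. complex_of_real (v x)) g) + I * (LINT x|M. g x)" for n
    unfolding eq[abs_def] mean_over_add mean_over_cmult mean_over_const[OF folner_sequenceD[OF F]] ..
  moreover have "(\<lambda>n. mean_over (F n) (correlation T M (\<lambda>x. complex_of_real (u x)) g)
      + \<i> * mean_over (F n) (correlation T M (\<lambda>x. complex_of_real (v x)) g) + I * (LINT x|M. g x))
    \<longlonglongrightarrow> 0 + \<i> * 0 + I * (LINT x|M. g x)"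
    by (intro tendsto_intros ergodic_correlation_real_zero[OF M erg F um uK u0 g]
        ergodic_correlation_real_zero[OF M erg F vm vK v0 g])
  ultimately show ?thesis by (simp add: I_def)
qed


section \<open>Extending correlation limits from generators\<close>

text \<open>The bound of \<open>\<Phi>\<^sub>n\<close> by the \<open>L\<^sup>1\<close> norm is uniform in \<open>n\<close>, and bounded pointwise limits are \<open>L\<^sup>1\<close> limits by
dominated convergence; this permits exchanging the limit in \<open>n\<close> with the one in the function.\<close>

lemma functional_limit_extension:
  fixes \<Phi> :: "nat \<Rightarrow> ('a \<Rightarrow> complex) \<Rightarrow> complex"
  assumes M: "prob_space M" and G: "\<And>g. g \<in> G \<Longrightarrow> bounded_measurable M g"
    and add: "\<And>n f g. bounded_measurable M f \<Longrightarrow> bounded_measurable M g \<Longrightarrow>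
      \<Phi> n (\<lambda>x. f x + g x) = \<Phi> n f + \<Phi> n g"
    and scale: "\<And>n f a. bounded_measurable M f \<Longrightarrow> \<Phi> n (\<lambda>x. a * f x) = a * \<Phi> n f"
    and bound: "\<And>n f. bounded_measurable M f \<Longrightarrow> norm (\<Phi> n f) \<le> L * (LINT x|M. norm (f x))"
    and gen: "\<And>g. g \<in> G \<Longrightarrow> (\<lambda>n. \<Phi> n g) \<longlonglongrightarrow> c * (LINT x|M. g x)"
    and f: "f \<in> bp_closure (space M) G"
  shows "(\<lambda>n. \<Phi> n f) \<longlonglongrightarrow> c * (LINT x|M. f x)"
  using f
proof induction
  case (base f)
  then show ?case by (rule gen)
next
  case (add f g)
  have bm: "bounded_measurable M f" "bounded_measurable M g"
    using add.hyps bp_closure_bounded_measurable G by blast+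
  then show ?case
    using tendsto_add[OF add.IH] bounded_measurable_integrable[OF M]
    by (simp add: assms(3) distrib_left)
next
  case (scale f a)
  have bm: "bounded_measurable M f"
    using scale.hyps bp_closure_bounded_measurable G by blast
  then show ?case
    using tendsto_mult_left[OF scale.IH, of a] by (simp add: assms(4) mult_ac)
next
  case (limit f K g)
  interpret prob_space M by (rule M)
  have fb: "bounded_measurable M (f i)" for i
    using limit.hyps(1) bp_closure_bounded_measurable G by blast
  have "g \<in> bp_closure (space M) G"
    by (rule bp_closure.limit[OF limit.hyps])
  then have gb: "bounded_measurable M g"
    using bp_closure_bounded_measurable G by blast
  have gK: "norm (g x) \<le> K" if "x \<in> space M" for x
    by (rule LIMSEQ_le_const2[OF tendsto_norm[OF limit.hyps(3)[OF that]]]) (use limit.hyps(2) that in blast)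
  define d where "d i x = g x + (-1) * f i x" for i x
  have db: "bounded_measurable M (d i)" for i
  proof -
    have "bounded_measurable M (\<lambda>x. - f i x)" using fb[of i] by (simp add: bounded_measurable_def)
    then show ?thesis unfolding bounded_measurable_def
    proof (intro conjI)
      show "d i \<in> borel_measurable M"
        using gb fb[of i] unfolding d_def[abs_def] bounded_measurable_def
        by (intro borel_measurable_add borel_measurable_times) auto
      have "norm (d i x) \<le> 2 * K" if "x \<in> space M" for x
        unfolding d_def using gK[OF that] limit.hyps(2)[OF that, of i] norm_triangle_ineq4[of "g x" "f i x"]
        by simp
      then show "\<exists>K. \<forall>x\<in>space M. norm (d i x) \<le> K" by blast
    qed
  qed
  have "(\<lambda>i. LINT x|M. norm (d i x)) \<longlonglongrightarrow> (LINT x|M. 0)"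
  proof (rule integral_dominated_convergence[where w = "\<lambda>_. 2 * K"])
    show "AE x in M. (\<lambda>i. norm (d i x)) \<longlonglongrightarrow> 0"
    proof (rule AE_I2)
      fix x assume "x \<in> space M"
      from tendsto_diff[OF tendsto_const limit.hyps(3)[OF this], of "g x"]
      show "(\<lambda>i. norm (d i x)) \<longlonglongrightarrow> 0"
        unfolding d_def by (intro tendsto_norm_zero) simp
    qed
    show "AE x in M. norm (norm (d i x)) \<le> 2 * K" for i
    proof (rule AE_I2)
      fix x assume "x \<in> space M"
      then show "norm (norm (d i x)) \<le> 2 * K"
        unfolding d_def using gK limit.hyps(2)[of x i] norm_triangle_ineq4[of "g x" "f i x"] by fastforce
    qed
    show "(\<lambda>x. norm (d i x)) \<in> borel_measurable M" for i
      by (rule measurable_compose[OF conjunct1[OF db[unfolded bounded_measurable_def]] borel_measurable_norm])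
  qed auto
  then have "(\<lambda>i. (L + norm c) * (LINT x|M. norm (d i x))) \<longlonglongrightarrow> 0"
    using tendsto_mult_left by fastforce
  then have small: "eventually (\<lambda>i. (L + norm c) * (LINT x|M. norm (d i x)) < e) sequentially" if "e > 0" for e
    by (rule order_tendstoD(2)[OF _ that])
  show ?case
  proof (rule LIMSEQ_I)
    fix e :: real assume e: "e > 0"
    obtain i where i: "(L + norm c) * (LINT x|M. norm (d i x)) < e / 2"
      using small[of "e / 2"] e by (auto simp: eventually_sequentially)
    obtain N where N: "\<And>n. n \<ge> N \<Longrightarrow> norm (\<Phi> n (f i) - c * (LINT x|M. f i x)) < e / 2"
      using LIMSEQ_D[OF limit.IH[of i], of "e / 2"] e by auto
    have "norm (\<Phi> n g - c * (LINT x|M. g x)) < e" if "n \<ge> N" for n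
    proof -
      have gd: "g = (\<lambda>x. d i x + f i x)" by (simp add: d_def)
      have "\<Phi> n g = \<Phi> n (d i) + \<Phi> n (f i)"
        by (subst gd) (rule assms(3)[OF db fb])
      moreover have "(LINT x|M. g x) = (LINT x|M. d i x) + (LINT x|M. f i x)"
        by (subst gd) (simp add: bounded_measurable_integrable[OF M] db fb)
      ultimately have "\<Phi> n g - c * (LINT x|M. g x)
          = \<Phi> n (d i) - c * (LINT x|M. d i x) + (\<Phi> n (f i) - c * (LINT x|M. f i x))"
        by (simp add: algebra_simps)
      then have "norm (\<Phi> n g - c * (LINT x|M. g x))
          \<le> norm (\<Phi> n (d i) - c * (LINT x|M. d i x)) + norm (\<Phi> n (f i) - c * (LINT x|M. f i x))"
        by (simp add: norm_triangle_ineq)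
      also have "norm (\<Phi> n (d i) - c * (LINT x|M. d i x))
          \<le> norm (\<Phi> n (d i)) + norm c * norm (LINT x|M. d i x)"
        using norm_triangle_ineq4[of "\<Phi> n (d i)" "c * (LINT x|M. d i x)"] by (simp add: norm_mult)
      also have "\<dots> \<le> L * (LINT x|M. norm (d i x)) + norm c * (LINT x|M. norm (d i x))"
        using bound[OF db, of n i] by (intro add_mono mult_left_mono integral_norm_bound) auto
      finally show ?thesis using i N[OF that] by (simp add: algebra_simps)
    qed
    then show "\<exists>N. \<forall>n\<ge>N. norm (\<Phi> n g - c * (LINT x|M. g x)) < e" by blast
  qed
qed

lemma correlation_add_left:
  assumes "prob_space M" "invariant_measure T M"
    and "bounded_measurable M f" "bounded_measurable M f'" "bounded_measurable M g"
  shows "correlation T M (\<lambda>x. f x + f' x) g j = correlation T M f g j + correlation T M f' g j"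
  using correlation_integrable[OF assms(1,2,3,5)] correlation_integrable[OF assms(1,2,4,5)]
  by (simp add: correlation_def distrib_right)

lemma correlation_add_right:
  assumes "prob_space M" "invariant_measure T M"
    and "bounded_measurable M f" "bounded_measurable M g" "bounded_measurable M g'"
  shows "correlation T M f (\<lambda>x. g x + g' x) j = correlation T M f g j + correlation T M f g' j"
  using correlation_integrable[OF assms(1,2,3,4)] correlation_integrable[OF assms(1,2,3,5)]
  by (simp add: correlation_def distrib_left)

lemma correlation_scale_left: "correlation T M (\<lambda>x. a * f x) g j = a * correlation T M f g j"
  by (simp add: correlation_def mult.assoc)

lemma correlation_scale_right: "correlation T M f (\<lambda>x. a * g x) j = a * correlation T M f g j"
  by (simp add: correlation_def mult.left_commute)

lemma norm_correlation_le_left: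
  assumes M: "prob_space M" and T: "invariant_measure T M"
    and f: "bounded_measurable M f" and g: "bounded_measurable M g"
    and L: "\<And>x. x \<in> space M \<Longrightarrow> norm (g x) \<le> L"
  shows "norm (correlation T M f g j) \<le> L * (LINT x|M. norm (f x))"
proof -
  note Tj = invariant_funpow[OF T, of j]
  have fm: "f \<in> borel_measurable M" using f by (simp add: bounded_measurable_def)
  have "norm (correlation T M f g j) \<le> (LINT x|M. norm (f ((T ^^ j) x) * g x))"
    by (simp add: correlation_def)
  also have "\<dots> \<le> (LINT x|M. L * norm (f ((T ^^ j) x)))"
    using integrable_norm[OF correlation_integrable[OF M T f g, of j]]
      bounded_measurable_integrable[OF M bounded_measurable_compose[OF f invariant_measurable[OF Tj]]]
    by (intro integral_mono) (auto simp: norm_mult mult.commute intro: mult_right_mono L)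
  also have "\<dots> = L * (LINT x|M. norm (f x))"
    using invariant_integral[OF Tj, of "\<lambda>x. norm (f x)"] fm by simp
  finally show ?thesis .
qed

lemma norm_correlation_le_right:
  assumes M: "prob_space M" and T: "invariant_measure T M"
    and f: "bounded_measurable M f" and g: "bounded_measurable M g"
    and K: "\<And>x. x \<in> space M \<Longrightarrow> norm (f x) \<le> K"
  shows "norm (correlation T M f g j) \<le> K * (LINT x|M. norm (g x))"
proof -
  note Tj = invariant_measurable[OF invariant_funpow[OF T, of j]]
  have "norm (correlation T M f g j) \<le> (LINT x|M. norm (f ((T ^^ j) x) * g x))"
    by (simp add: correlation_def)
  also have "\<dots> \<le> (LINT x|M. K * norm (g x))"
    using integrable_norm[OF correlation_integrable[OF M T f g, of j]] bounded_measurable_integrable[OF M g]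
    by (intro integral_mono) (auto simp: norm_mult intro!: mult_right_mono K measurable_space[OF Tj])
  finally show ?thesis by simp
qed

text \<open>The uniform bounds come from \<open>norm_correlation_le_left\<close> (where invariance is essential) and
\<open>norm_correlation_le_right\<close>. No Folner condition is imposed, so that \<open>F n = {n}\<close> covers plain convergence
of correlations, as needed for strong mixing.\<close>

lemma correlation_limit_extension:
  assumes M: "prob_space M" and T: "invariant_measure T M"
    and F: "\<And>n. finite (F n)" "\<And>n. F n \<noteq> {}"
    and G: "\<And>g. g \<in> G \<Longrightarrow> bounded_measurable M g"
    and gen: "\<And>f g. f \<in> G \<Longrightarrow> g \<in> G \<Longrightarrow>
      (\<lambda>n. mean_over (F n) (correlation T M f g)) \<longlonglongrightarrow> (LINT x|M. f x) * (LINT x|M. g x)"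
    and f: "f \<in> bp_closure (space M) G" and g: "g \<in> bp_closure (space M) G"
  shows "(\<lambda>n. mean_over (F n) (correlation T M f g)) \<longlonglongrightarrow> (LINT x|M. f x) * (LINT x|M. g x)"
proof -
  have left: "(\<lambda>n. mean_over (F n) (correlation T M f h)) \<longlonglongrightarrow> (LINT x|M. f x) * (LINT x|M. h x)"
    if h: "h \<in> G" for h
  proof -
    obtain L where L: "\<And>x. x \<in> space M \<Longrightarrow> norm (h x) \<le> L"
      using G[OF h] by (auto simp: bounded_measurable_def)
    have "(\<lambda>n. mean_over (F n) (correlation T M f h)) \<longlonglongrightarrow> (LINT x|M. h x) * (LINT x|M. f x)"
    proof (rule functional_limit_extension[OF M G _ _ _ _ f])
      show "mean_over (F n) (correlation T M (\<lambda>x. u x + v x) h)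
          = mean_over (F n) (correlation T M u h) + mean_over (F n) (correlation T M v h)"
        if "bounded_measurable M u" "bounded_measurable M v" for n u v
        unfolding correlation_add_left[OF M T that G[OF h], abs_def] mean_over_add ..
      show "mean_over (F n) (correlation T M (\<lambda>x. a * u x) h) = a * mean_over (F n) (correlation T M u h)"
        for n a u
        unfolding correlation_scale_left[abs_def] mean_over_cmult ..
      show "norm (mean_over (F n) (correlation T M u h)) \<le> L * (LINT x|M. norm (u x))"
        if "bounded_measurable M u" for n u
        by (intro mean_over_bound F norm_correlation_le_left[OF M T that G[OF h] L])
      show "(\<lambda>n. mean_over (F n) (correlation T M u h)) \<longlonglongrightarrow> (LINT x|M. h x) * (LINT x|M. u x)"
        if "u \<in> G" for u
        using gen[OF that h] by (simp add: mult.commute)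
    qed
    then show ?thesis by (simp add: mult.commute)
  qed
  have fb: "bounded_measurable M f"
    by (rule bp_closure_bounded_measurable[OF f G])
  obtain K where K: "\<And>x. x \<in> space M \<Longrightarrow> norm (f x) \<le> K"
    using fb by (auto simp: bounded_measurable_def)
  show ?thesis
  proof (rule functional_limit_extension[OF M G _ _ _ left g])
    show "mean_over (F n) (correlation T M f (\<lambda>x. u x + v x))
        = mean_over (F n) (correlation T M f u) + mean_over (F n) (correlation T M f v)"
      if "bounded_measurable M u" "bounded_measurable M v" for n u v
      unfolding correlation_add_right[OF M T fb that, abs_def] mean_over_add ..
    show "mean_over (F n) (correlation T M f (\<lambda>x. a * u x)) = a * mean_over (F n) (correlation T M f u)"
      for n a u
      unfolding correlation_scale_right[abs_def] mean_over_cmult ..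
    show "norm (mean_over (F n) (correlation T M f u)) \<le> K * (LINT x|M. norm (u x))"
      if "bounded_measurable M u" for n u
      by (intro mean_over_bound F norm_correlation_le_right[OF M T fb that K])
  qed
qed

lemma bounded_measurable_indicator: "A \<in> sets M \<Longrightarrow> bounded_measurable M (indicator A)"
  by (auto simp: bounded_measurable_def indicator_def intro!: exI[of _ 1])

lemma integral_complex_indicator:
  "A \<in> sets M \<Longrightarrow> (LINT x|M. indicator A x :: complex) = complex_of_real (measure M A)"
proof -
  assume A: "A \<in> sets M"
  have "(LINT x|M. indicator A x :: complex) = (LINT x|M. complex_of_real (indicator A x))"
    by (rule Bochner_Integration.integral_cong) (auto simp: indicator_def)
  also have "\<dots> = complex_of_real (measure M A)"
    using sets.sets_into_space[OF A] by (simp add: Int_absorb2)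
  finally show ?thesis .
qed

lemma correlation_indicator:
  assumes T: "invariant_measure T M" and A: "A \<in> sets M" and B: "B \<in> sets M"
  shows "correlation T M (indicator A) (indicator B) j = complex_of_real (measure M ((T ^^ j) -` A \<inter> B))"
proof -
  have "(T ^^ j) -` A \<inter> B = (T ^^ j) -` A \<inter> space M \<inter> B"
    using sets.sets_into_space[OF B] by auto
  then have "(T ^^ j) -` A \<inter> B \<in> sets M"
    using measurable_sets[OF invariant_measurable[OF invariant_funpow[OF T]] A] B by simp
  from integral_complex_indicator[OF this] show ?thesis
    by (simp add: correlation_def indicator_def of_bool_conj flip: integral_complex_indicator)
qed

lemma ergodic_of_correlation_limit:
  assumes M: "prob_space M" and T: "invariant_measure T M"
    and F: "\<And>n. finite (F n)" "\<And>n. F n \<noteq> {}"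
    and G: "\<And>g. g \<in> G \<Longrightarrow> bounded_measurable M g"
    and gen: "\<And>f g. f \<in> G \<Longrightarrow> g \<in> G \<Longrightarrow>
      (\<lambda>n. mean_over (F n) (correlation T M f g)) \<longlonglongrightarrow> (LINT x|M. f x) * (LINT x|M. g x)"
    and ind: "\<And>A. A \<in> sets M \<Longrightarrow> indicator A \<in> bp_closure (space M) G"
  shows "ergodic_measure T M"
  unfolding ergodic_measure_def
proof (intro conjI ballI impI T)
  fix B assume B: "B \<in> sets M" and inv: "T -` B \<inter> space M = B"
  have "(T ^^ j) x \<in> B \<longleftrightarrow> x \<in> B" if "x \<in> space M" for x j
    using that
  proof (induction j arbitrary: x)
    case (Suc j)
    have "T x \<in> space M" using measurable_space[OF invariant_measurable[OF T] Suc.prems] .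
    moreover have "T x \<in> B \<longleftrightarrow> x \<in> B" using inv Suc.prems by blast
    ultimately show ?case using Suc.IH[of "T x"] by (simp add: funpow_Suc_right del: funpow.simps)
  qed simp
  then have "(T ^^ j) -` B \<inter> B = B" for j
    using sets.sets_into_space[OF B] by blast
  then have "mean_over (F n) (correlation T M (indicator B) (indicator B)) = complex_of_real (measure M B)" for n
    unfolding correlation_indicator[OF T B B, abs_def] by (simp add: mean_over_const[OF F])
  moreover have "(\<lambda>n. mean_over (F n) (correlation T M (indicator B) (indicator B)))
      \<longlonglongrightarrow> (LINT x|M. indicator B x) * (LINT x|M. indicator B x)"
    by (rule correlation_limit_extension[OF M T F G gen ind[OF B] ind[OF B]])
  ultimately have "complex_of_real (measure M B) = complex_of_real (measure M B * measure M B)"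
    by (simp add: integral_complex_indicator[OF B] LIMSEQ_const_iff)
  then have "measure M B = measure M B * measure M B"
    by (simp only: of_real_eq_iff)
  then show "(measure M B)\<^sup>2 = measure M B"
    by (simp add: power2_eq_square)
qed

text \<open>With characters as generators this is the uniqueness theorem for Fourier coefficients.\<close>

lemma bp_closure_measure_eqI:
  assumes M: "prob_space M" and N: "prob_space N" and sets: "sets N = sets M"
    and G: "\<And>g. g \<in> G \<Longrightarrow> bounded_measurable M g"
    and eq: "\<And>g. g \<in> G \<Longrightarrow> (LINT x|N. g x) = (LINT x|M. g x)"
    and ind: "\<And>A. A \<in> sets M \<Longrightarrow> indicator A \<in> bp_closure (space M) G"
  shows "N = M"
proof (rule measure_eqI)
  interpret M: prob_space M by fact
  interpret N: prob_space N by fact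
  have space: "space N = space M" by (rule sets_eq_imp_space_eq[OF sets])
  have bm: "bounded_measurable N f" if "bounded_measurable M f" for f
    using that by (simp add: bounded_measurable_def space measurable_cong_sets[OF sets refl])
  have int: "(LINT x|N. f x) = (LINT x|M. f x)" if "f \<in> bp_closure (space M) G" for f
    using that
  proof induction
    case (add f g)
    have "bounded_measurable M f" "bounded_measurable M g"
      using add.hyps bp_closure_bounded_measurable G by blast+
    then show ?case
      using add.IH bounded_measurable_integrable[OF M] bounded_measurable_integrable[OF N] bm by simp
  next
    case (limit f K g)
    have fm: "f i \<in> borel_measurable M" "f i \<in> borel_measurable N" for i
      using bp_closure_bounded_measurable[OF limit.hyps(1)[of i] G] bm by (auto simp: bounded_measurable_def)
    have gm: "g \<in> borel_measurable M" "g \<in> borel_measurable N"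
      using bp_closure_bounded_measurable[OF bp_closure.limit[OF limit.hyps] G] bm
      by (auto simp: bounded_measurable_def)
    have "(\<lambda>i. LINT x|M. f i x) \<longlonglongrightarrow> (LINT x|M. g x)"
      by (rule integral_dominated_convergence[where w = "\<lambda>_. K"])
        (use fm gm limit.hyps(2,3) in auto)
    moreover have "(\<lambda>i. LINT x|N. f i x) \<longlonglongrightarrow> (LINT x|N. g x)"
      by (rule integral_dominated_convergence[where w = "\<lambda>_. K"])
        (use fm gm limit.hyps(2,3) in \<open>auto simp: space\<close>)
    ultimately show ?case unfolding limit.IH using LIMSEQ_unique by blast
  qed (auto simp: eq)
  fix A assume A: "A \<in> sets N"
  then have "complex_of_real (measure N A) = complex_of_real (measure M A)"
    using int[OF ind[of A]] integral_complex_indicator[of A M] integral_complex_indicator[of A N] sets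
    by simp
  then show "emeasure N A = emeasure M A"
    by (simp add: M.emeasure_eq_measure N.emeasure_eq_measure)
qed (rule sets)

section \<open>Mean-square limits and product systems\<close>

definition tensor :: "('a \<Rightarrow> complex) \<Rightarrow> ('b \<Rightarrow> complex) \<Rightarrow> 'a \<times> 'b \<Rightarrow> complex" where
  "tensor f g z = f (fst z) * g (snd z)"

lemma bounded_measurable_tensor:
  "bounded_measurable M f \<Longrightarrow> bounded_measurable N g \<Longrightarrow> bounded_measurable (M \<Otimes>\<^sub>M N) (tensor f g)"
  unfolding tensor_def[abs_def]
  by (intro bounded_measurable_mult bounded_measurable_compose[OF _ measurable_fst]
      bounded_measurable_compose[OF _ measurable_snd])

lemma integral_tensor:
  assumes M: "prob_space M" and N: "prob_space N"
    and f: "bounded_measurable M f" and g: "bounded_measurable N g"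
  shows "(LINT z|(M \<Otimes>\<^sub>M N). tensor f g z) = (LINT x|M. f x) * (LINT y|N. g y)"
proof -
  interpret M: prob_space M by fact
  interpret N: prob_space N by fact
  interpret pair_prob_space M N ..
  have "integrable (M \<Otimes>\<^sub>M N) (tensor f g)"
    by (intro bounded_measurable_integrable bounded_measurable_tensor f g) unfold_locales
  from integral_fst'[OF this] show ?thesis by (simp add: tensor_def[abs_def])
qed

lemma map_prod_funpow:
  fixes f :: "'a \<Rightarrow> 'a" and g :: "'b \<Rightarrow> 'b"
  shows "(map_prod f g ^^ n) = map_prod (f ^^ n) (g ^^ n)"
  by (induction n) (auto simp: fun_eq_iff map_prod_def split: prod.splits)

lemma correlation_tensor:
  assumes M: "prob_space M" and T: "invariant_measure T M"
    and "bounded_measurable M f" "bounded_measurable M f'" "bounded_measurable M g" "bounded_measurable M g'"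
  shows "correlation (map_prod T T) (M \<Otimes>\<^sub>M M) (tensor f f') (tensor g g') j
    = correlation T M f g j * correlation T M f' g' j"
proof -
  note Tj = measurable_compose_n[OF invariant_measurable[OF T], of j]
  have "correlation (map_prod T T) (M \<Otimes>\<^sub>M M) (tensor f f') (tensor g g') j
    = (LINT z|(M \<Otimes>\<^sub>M M). tensor (\<lambda>x. f ((T ^^ j) x) * g x) (\<lambda>x. f' ((T ^^ j) x) * g' x) z)"
    by (simp add: correlation_def tensor_def map_prod_funpow mult_ac)
  then show ?thesis
    using integral_tensor[OF M M] assms(3-6)
    by (simp add: correlation_def bounded_measurable_mult bounded_measurable_compose[OF _ Tj])
qed

lemma invariant_map_prod:
  assumes "prob_space M" and T: "invariant_measure T M"
  shows "invariant_measure (map_prod T T) (M \<Otimes>\<^sub>M M)"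
proof (rule distr_invariant)
  interpret prob_space M by fact
  have mp: "map_prod T T = (\<lambda>(x, y). (T x, T y))" by (auto simp: fun_eq_iff)
  note Tm = invariant_measurable[OF T]
  show "map_prod T T \<in> M \<Otimes>\<^sub>M M \<rightarrow>\<^sub>M M \<Otimes>\<^sub>M M"
    unfolding mp using Tm by measurable
  have "sigma_finite_measure (distr M M T)"
    unfolding invariant_distr[OF T] by unfold_locales
  from pair_measure_distr[OF Tm Tm this]
  show "distr (M \<Otimes>\<^sub>M M) (M \<Otimes>\<^sub>M M) (map_prod T T) = M \<Otimes>\<^sub>M M"
    unfolding mp invariant_distr[OF T] by simp
qed

lemma indicator_in_bp_closure_tensor:
  assumes G: "\<And>g. g \<in> G \<Longrightarrow> bounded_measurable M g"
    and ind: "\<And>A. A \<in> sets M \<Longrightarrow> indicator A \<in> bp_closure (space M) G"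
    and A: "A \<in> sets (M \<Otimes>\<^sub>M M)"
  shows "indicator A \<in> bp_closure (space (M \<Otimes>\<^sub>M M)) {tensor f g | f g. f \<in> G \<and> g \<in> G}"
    (is "_ \<in> bp_closure ?X ?E")
proof -
  have E: "\<exists>K. \<forall>z\<in>?X. norm (h z) \<le> K" if "h \<in> ?E" for h
    using that bounded_measurable_tensor[OF G G] by (auto simp: bounded_measurable_def)
  have rect: "indicator (B \<times> C) \<in> bp_closure ?X ?E" if BC: "B \<in> sets M" "C \<in> sets M" for B C
  proof -
    have proj: "fst z \<in> space M" "snd z \<in> space M" if "z \<in> ?X" for z
      using that by (auto simp: space_pair_measure)
    have bdd: "\<exists>K. \<forall>z\<in>?X. norm (h z) \<le> K" if "h \<in> (\<lambda>g z. g (\<phi> z)) ` G" "\<And>z. z \<in> ?X \<Longrightarrow> \<phi> z \<in> space M"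
      for h and \<phi> :: "'a \<times> 'a \<Rightarrow> 'a"
      using that G unfolding bounded_measurable_def by blast
    have "(\<lambda>z. indicator B (fst z) * indicator C (snd z)) \<in> bp_closure ?X ?E"
    proof (rule bp_closure_mult[OF bp_closure_compose[OF ind[OF BC(1)] proj(1)]
          bp_closure_compose[OF ind[OF BC(2)] proj(2)]])
      fix u v :: "'a \<times> 'a \<Rightarrow> complex"
      assume "u \<in> (\<lambda>g z. g (fst z)) ` G" "v \<in> (\<lambda>g z. g (snd z)) ` G"
      then obtain f g where "f \<in> G" "g \<in> G" "u = (\<lambda>z. f (fst z))" "v = (\<lambda>z. g (snd z))" by blast
      then show "(\<lambda>z. u z * v z) \<in> bp_closure ?X ?E"
        by (intro bp_closure.base) (auto simp: tensor_def[abs_def])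
    qed (use bdd proj in blast)+
    then show ?thesis
      by (rule bp_closure_cong[OF _ E]) (auto simp: indicator_def mem_Times_iff)
  qed
  show ?thesis
  proof (rule bp_closure_indicator[OF Int_stable_pair_measure_generator pair_measure_closed])
    show "?X \<subseteq> space M \<times> space M" by (simp add: space_pair_measure)
    show "A \<in> sigma_sets (space M \<times> space M) {a \<times> b | a b. a \<in> sets M \<and> b \<in> sets M}"
      using A by (simp add: sets_pair_measure)
    show "(\<lambda>_. 1) \<in> bp_closure ?X ?E"
      by (rule bp_closure_cong[OF rect[OF sets.top sets.top] E]) (auto simp: space_pair_measure)
  qed (use E rect in auto)
qed

lemma mean_over_norm_null:
  fixes a :: "nat \<Rightarrow> complex"
  assumes F: "\<And>n. finite (F n)" "\<And>n. F n \<noteq> {}"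
    and lim: "(\<lambda>n. mean_over (F n) (\<lambda>j. (norm (a j))\<^sup>2)) \<longlonglongrightarrow> 0"
  shows "(\<lambda>n. mean_over (F n) (\<lambda>j. norm (a j))) \<longlonglongrightarrow> 0"
proof -
  have bound: "norm (mean_over (F n) (\<lambda>j. norm (a j))) \<le> sqrt (mean_over (F n) (\<lambda>j. (norm (a j))\<^sup>2))" for n
    using power2_mean_over_le[OF F, of n "\<lambda>j. norm (a j)"] by (simp add: real_le_rsqrt abs_le_square_iff)
  have "(\<lambda>n. sqrt (mean_over (F n) (\<lambda>j. (norm (a j))\<^sup>2))) \<longlonglongrightarrow> 0"
    using tendsto_real_sqrt[OF lim] by simp
  then show ?thesis by (rule Lim_null_comparison[OF always_eventually[OF allI[OF bound]]])
qed

lemma mean_over_limit_of_mean_square: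
  fixes a :: "nat \<Rightarrow> complex"
  assumes F: "\<And>n. finite (F n)" "\<And>n. F n \<noteq> {}"
    and lim: "(\<lambda>n. mean_over (F n) (\<lambda>j. (norm (a j - c))\<^sup>2)) \<longlonglongrightarrow> 0"
  shows "(\<lambda>n. mean_over (F n) a) \<longlonglongrightarrow> c"
proof -
  have "norm (mean_over (F n) a - c) \<le> mean_over (F n) (\<lambda>j. norm (a j - c))" for n
    using norm_mean_over_le[OF F, of n "\<lambda>j. a j - c"]
    by (simp add: mean_over_diff mean_over_const[OF F])
  then have "(\<lambda>n. mean_over (F n) a - c) \<longlonglongrightarrow> 0"
    by (intro Lim_null_comparison[OF always_eventually mean_over_norm_null[OF F lim]] allI)
  then show ?thesis by (simp add: LIM_zero_iff)
qed

text \<open>From \<open>a b - c d = (a - c) b + c (b - d)\<close>, with the mean absolute deviations controlled by the mean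
square ones.\<close>

lemma mean_over_product_limit_of_mean_square:
  fixes a b :: "nat \<Rightarrow> complex"
  assumes F: "\<And>n. finite (F n)" "\<And>n. F n \<noteq> {}"
    and a: "(\<lambda>n. mean_over (F n) (\<lambda>j. (norm (a j - c))\<^sup>2)) \<longlonglongrightarrow> 0"
    and b: "(\<lambda>n. mean_over (F n) (\<lambda>j. (norm (b j - d))\<^sup>2)) \<longlonglongrightarrow> 0"
    and K: "\<And>j. norm (b j) \<le> K"
  shows "(\<lambda>n. mean_over (F n) (\<lambda>j. a j * b j)) \<longlonglongrightarrow> c * d"
proof -
  have bound: "norm (mean_over (F n) (\<lambda>j. a j * b j) - c * d)
      \<le> K * mean_over (F n) (\<lambda>j. norm (a j - c)) + norm c * mean_over (F n) (\<lambda>j. norm (b j - d))" for n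
  proof -
    have "norm (mean_over (F n) (\<lambda>j. a j * b j) - c * d)
        \<le> mean_over (F n) (\<lambda>j. norm (a j * b j - c * d))"
      using norm_mean_over_le[OF F, of n "\<lambda>j. a j * b j - c * d"]
      by (simp add: mean_over_diff mean_over_const[OF F])
    also have "\<dots> \<le> mean_over (F n) (\<lambda>j. K * norm (a j - c) + norm c * norm (b j - d))"
    proof (rule mean_over_mono)
      fix j
      have "a j * b j - c * d = (a j - c) * b j + c * (b j - d)" by (simp add: algebra_simps)
      then have "norm (a j * b j - c * d) \<le> norm (a j - c) * norm (b j) + norm c * norm (b j - d)"
        by (metis norm_mult norm_triangle_ineq)
      also have "norm (a j - c) * norm (b j) \<le> K * norm (a j - c)"
        using mult_left_mono[OF K, of "norm (a j - c)" j] by (simp add: mult.commute)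
      finally show "norm (a j * b j - c * d) \<le> K * norm (a j - c) + norm c * norm (b j - d)" by simp
    qed
    finally show ?thesis by (simp add: mean_over_add mean_over_cmult)
  qed
  have "(\<lambda>n. K * mean_over (F n) (\<lambda>j. norm (a j - c)) + norm c * mean_over (F n) (\<lambda>j. norm (b j - d)))
      \<longlonglongrightarrow> K * 0 + norm c * 0"
    by (intro tendsto_intros mean_over_norm_null F a b)
  then have "(\<lambda>n. mean_over (F n) (\<lambda>j. a j * b j) - c * d) \<longlonglongrightarrow> 0"
    by (intro Lim_null_comparison[OF always_eventually[OF allI[OF bound]]]) simp
  then show ?thesis by (simp add: LIM_zero_iff)
qed

lemma bounded_measurable_cnj:
  assumes "bounded_measurable M f"
  shows "bounded_measurable M (\<lambda>x. cnj (f x))"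
proof -
  have "cnj \<in> borel_measurable borel"
    by (intro borel_measurable_continuous_onI continuous_intros)
  then show ?thesis
    using assms unfolding bounded_measurable_def complex_mod_cnj by (blast intro: measurable_compose)
qed

text \<open>Expand \<open>|a\<^sub>j - c|\<^sup>2 = a\<^sub>j cnj a\<^sub>j - cnj c a\<^sub>j - c cnj a\<^sub>j + |c|\<^sup>2\<close>. Each term is a product of two correlations,
the second possibly that of the constant 1 with itself, hence a correlation of the ergodic product
system; the four limits cancel.\<close>

lemma weakly_mixing_correlation:
  assumes M: "prob_space M" and wm: "weakly_mixing_measure T M" and F: "folner_sequence F"
    and f: "bounded_measurable M f" and g: "bounded_measurable M g"
  shows "(\<lambda>n. mean_over (F n) (\<lambda>j. (norm (correlation T M f g j - (LINT x|M. f x) * (LINT x|M. g x)))\<^sup>2))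
    \<longlonglongrightarrow> 0"
proof -
  interpret prob_space M by fact
  interpret pair_prob_space M M ..
  have T: "invariant_measure T M" and erg: "ergodic_measure (map_prod T T) (M \<Otimes>\<^sub>M M)"
    using wm by (auto simp: weakly_mixing_measure_def)
  have MM: "prob_space (M \<Otimes>\<^sub>M M)" by unfold_locales
  let ?cf = "\<lambda>x. cnj (f x)" and ?cg = "\<lambda>x. cnj (g x)" and ?one = "\<lambda>_. 1 :: complex"
  have cf: "bounded_measurable M ?cf" and cg: "bounded_measurable M ?cg"
    using f g by (auto intro: bounded_measurable_cnj)
  have one: "bounded_measurable M ?one" by (auto simp: bounded_measurable_def)
  define c where "c = (LINT x|M. f x) * (LINT x|M. g x)"
  define a where "a = correlation T M f g"
  have acnj: "correlation T M ?cf ?cg j = cnj (a j)" for j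
    unfolding a_def correlation_def complex_cnj_mult[symmetric] by (rule Bochner_Integration.integral_cnj)
  have prod: "(\<lambda>n. mean_over (F n) (\<lambda>j. correlation T M u v j * correlation T M u' v' j))
      \<longlonglongrightarrow> (LINT x|M. u x) * (LINT x|M. u' x) * ((LINT x|M. v x) * (LINT x|M. v' x))"
    if b: "bounded_measurable M u" "bounded_measurable M u'" "bounded_measurable M v" "bounded_measurable M v'"
    for u u' v v'
    using ergodic_correlation[OF MM erg F bounded_measurable_tensor[OF b(1,2)] bounded_measurable_tensor[OF b(3,4)]]
    unfolding correlation_tensor[OF M T b, abs_def] integral_tensor[OF M M b(1,2)] integral_tensor[OF M M b(3,4)] .
  have one_integral: "(LINT x|M. 1 :: complex) = 1"
    using prob_space.prob_space[OF M] by simp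
  have one_corr: "correlation T M ?one ?one j = 1" for j
    by (simp add: correlation_def one_integral del: lebesgue_integral_const)
  have sq: "(\<lambda>n. mean_over (F n) (\<lambda>j. a j * cnj (a j))) \<longlonglongrightarrow> c * cnj c"
    using prod[OF f cf g cg] by (simp add: acnj a_def[symmetric] c_def mult_ac)
  have lin: "(\<lambda>n. mean_over (F n) a) \<longlonglongrightarrow> c"
    using prod[OF f one g one] by (simp add: one_corr a_def[symmetric] c_def one_integral del: lebesgue_integral_const)
  have cnj_lin: "(\<lambda>n. mean_over (F n) (\<lambda>j. cnj (a j))) \<longlonglongrightarrow> cnj c"
    using prod[OF cf one cg one] by (simp add: one_corr acnj c_def one_integral del: lebesgue_integral_const)
  have "complex_of_real (mean_over (F n) (\<lambda>j. (norm (a j - c))\<^sup>2))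
      = mean_over (F n) (\<lambda>j. a j * cnj (a j)) - cnj c * mean_over (F n) a
        - c * mean_over (F n) (\<lambda>j. cnj (a j)) + c * cnj c" for n
  proof -
    have "complex_of_real (mean_over (F n) (\<lambda>j. (norm (a j - c))\<^sup>2))
        = mean_over (F n) (\<lambda>j. complex_of_real ((norm (a j - c))\<^sup>2))"
      by (simp add: mean_over_def)
    also have "\<dots> = mean_over (F n) (\<lambda>j. a j * cnj (a j) - cnj c * a j - c * cnj (a j) + c * cnj c)"
      unfolding complex_norm_square by (simp add: algebra_simps)
    finally show ?thesis
      by (simp only: mean_over_add mean_over_diff mean_over_cmult mean_over_const[OF folner_sequenceD[OF F]])
  qed
  moreover have "(\<lambda>n. mean_over (F n) (\<lambda>j. a j * cnj (a j)) - cnj c * mean_over (F n) a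
        - c * mean_over (F n) (\<lambda>j. cnj (a j)) + c * cnj c) \<longlonglongrightarrow> c * cnj c - cnj c * c - c * cnj c + c * cnj c"
    by (intro tendsto_intros sq lin cnj_lin)
  ultimately have "(\<lambda>n. complex_of_real (mean_over (F n) (\<lambda>j. (norm (a j - c))\<^sup>2))) \<longlonglongrightarrow> complex_of_real 0"
    by (simp add: mult.commute)
  then show ?thesis
    unfolding tendsto_of_real_iff a_def c_def .
qed

lemma weakly_mixing_of_mean_square_limit:
  assumes M: "prob_space M" and T: "invariant_measure T M"
    and F: "\<And>n. finite (F n)" "\<And>n. F n \<noteq> {}"
    and G: "\<And>g. g \<in> G \<Longrightarrow> bounded_measurable M g"
    and gen: "\<And>f g. f \<in> G \<Longrightarrow> g \<in> G \<Longrightarrow> (\<lambda>n. mean_over (F n)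
      (\<lambda>j. (norm (correlation T M f g j - (LINT x|M. f x) * (LINT x|M. g x)))\<^sup>2)) \<longlonglongrightarrow> 0"
    and ind: "\<And>A. A \<in> sets M \<Longrightarrow> indicator A \<in> bp_closure (space M) G"
  shows "weakly_mixing_measure T M"
  unfolding weakly_mixing_measure_def
proof (intro conjI T ergodic_of_correlation_limit[OF _ _ F])
  interpret prob_space M by fact
  interpret pair_prob_space M M ..
  show "prob_space (M \<Otimes>\<^sub>M M)" by unfold_locales
  show "invariant_measure (map_prod T T) (M \<Otimes>\<^sub>M M)" by (rule invariant_map_prod[OF M T])
  show "bounded_measurable (M \<Otimes>\<^sub>M M) h" if "h \<in> {tensor f g | f g. f \<in> G \<and> g \<in> G}" for h
    using that bounded_measurable_tensor[OF G G] by blast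
  show "indicator A \<in> bp_closure (space (M \<Otimes>\<^sub>M M)) {tensor f g | f g. f \<in> G \<and> g \<in> G}"
    if "A \<in> sets (M \<Otimes>\<^sub>M M)" for A
    by (rule indicator_in_bp_closure_tensor[OF G ind that])
  fix h k assume "h \<in> {tensor f g | f g. f \<in> G \<and> g \<in> G}" "k \<in> {tensor f g | f g. f \<in> G \<and> g \<in> G}"
  then obtain f f' g g' where h: "h = tensor f f'" and k: "k = tensor g g'"
    and mem: "f \<in> G" "f' \<in> G" "g \<in> G" "g' \<in> G" by blast
  note b = mem[THEN G]
  obtain K where K: "\<And>x. x \<in> space M \<Longrightarrow> norm (f' x) \<le> K"
    using b(2) by (auto simp: bounded_measurable_def)
  show "(\<lambda>n. mean_over (F n) (correlation (map_prod T T) (M \<Otimes>\<^sub>M M) h k))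
      \<longlonglongrightarrow> (LINT z|(M \<Otimes>\<^sub>M M). h z) * (LINT z|(M \<Otimes>\<^sub>M M). k z)"
    using mean_over_product_limit_of_mean_square[OF F gen[OF mem(1,3)] gen[OF mem(2,4)]
        norm_correlation_le_right[OF M T b(2,4) K]]
    unfolding h k correlation_tensor[OF M T b, abs_def] integral_tensor[OF M M b(1,2)] integral_tensor[OF M M b(3,4)]
    by (simp add: mult_ac)
qed

section \<open>Powers on the circle\<close>

lemma circle_measureD:
  assumes "circle_measure \<mu>"
  shows "prob_space \<mu>" "sets \<mu> = sets (restrict_space borel unit_circle)" "space \<mu> = unit_circle"
proof -
  show "prob_space \<mu>" and sets: "sets \<mu> = sets (restrict_space borel unit_circle)"
    using assms by (auto simp: circle_measure_def)
  show "space \<mu> = unit_circle"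
    using sets_eq_imp_space_eq[OF sets] by (simp add: space_restrict_space)
qed

lemma continuous_on_character: "continuous_on unit_circle (\<lambda>z. z powi k)"
  by (intro continuous_on_power_int continuous_on_id) auto

lemma circle_measurable_character:
  assumes "circle_measure \<mu>"
  shows "(\<lambda>z. z powi k) \<in> borel_measurable \<mu>"
  using borel_measurable_continuous_on_restrict[OF continuous_on_character]
  by (simp add: measurable_cong_sets[OF circle_measureD(2)[OF assms] refl])

lemma characters_bounded_measurable:
  assumes "circle_measure \<mu>" "g \<in> characters"
  shows "bounded_measurable \<mu> g"
  using assms(2) circle_measurable_character[OF assms(1)] characters_bounded[OF assms(2)]
  unfolding bounded_measurable_def circle_measureD(3)[OF assms(1)] by (auto simp: characters_def)

lemma circle_indicator:
  assumes "circle_measure \<mu>" "A \<in> sets \<mu>"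
  shows "indicator A \<in> bp_closure (space \<mu>) characters"
proof -
  have "A \<in> sets borel"
    using assms(2) unfolding circle_measureD(2)[OF assms(1)] by (auto simp: sets_restrict_space)
  then show ?thesis
    unfolding circle_measureD(3)[OF assms(1)] by (rule indicator_in_bp_closure_characters)
qed

lemma times_map_measurable:
  assumes "circle_measure \<mu>"
  shows "times_map p \<in> \<mu> \<rightarrow>\<^sub>M \<mu>"
proof -
  have "times_map p \<in> \<mu> \<rightarrow>\<^sub>M restrict_space borel unit_circle"
  proof (rule measurable_restrict_space2)
    show "times_map p \<in> space \<mu> \<rightarrow> unit_circle"
      by (auto simp: circle_measureD(3)[OF assms] times_map_def norm_power_int)
    show "times_map p \<in> borel_measurable \<mu>"
      using circle_measurable_character[OF assms, of p] by (simp add: times_map_def[abs_def])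
  qed
  then show ?thesis
    by (simp add: measurable_cong_sets[OF refl circle_measureD(2)[OF assms]])
qed

lemma times_map_funpow: "(times_map p ^^ j) z = z powi (p ^ j)"
proof (induction j)
  case (Suc j)
  have "z powi (p ^ j * p) = (z powi (p ^ j)) powi p" by (rule power_int_mult)
  then show ?case using Suc by (simp add: times_map_def mult.commute)
qed simp

lemma integral_character_times_map_funpow:
  assumes "circle_measure \<mu>"
  shows "(LINT z|\<mu>. ((times_map p ^^ j) z) powi k * z powi l) = fourier_coeff \<mu> (k * p ^ j + l)"
  unfolding fourier_coeff_def
proof (rule Bochner_Integration.integral_cong[OF refl])
  fix z assume "z \<in> space \<mu>"
  then have "z \<noteq> 0" by (auto simp: circle_measureD(3)[OF assms])
  then show "((times_map p ^^ j) z) powi k * z powi l = z powi (k * p ^ j + l)"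
    by (simp add: times_map_funpow power_int_add mult.commute[of k] power_int_mult)
qed

lemma correlation_characters:
  assumes "circle_measure \<mu>"
  shows "correlation (times_map p) \<mu> (\<lambda>z. z powi k) (\<lambda>z. z powi l) j = fourier_coeff \<mu> (k * p ^ j + l)"
  unfolding correlation_def by (rule integral_character_times_map_funpow[OF assms])

lemma fourier_coeff_0: "circle_measure \<mu> \<Longrightarrow> fourier_coeff \<mu> 0 = 1"
  using prob_space.prob_space[OF circle_measureD(1)] by (simp add: fourier_coeff_def)

lemma norm_fourier_coeff_le:
  assumes "circle_measure \<mu>"
  shows "norm (fourier_coeff \<mu> k) \<le> 1"
proof -
  interpret prob_space \<mu> by (rule circle_measureD(1)[OF assms])
  have "norm (fourier_coeff \<mu> k) \<le> (LINT z|\<mu>. norm (z powi k))"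
    by (simp add: fourier_coeff_def)
  also have "\<dots> = (LINT z|\<mu>. 1)"
    by (rule Bochner_Integration.integral_cong) (auto simp: circle_measureD(3)[OF assms] norm_power_int)
  finally show ?thesis by (simp add: prob_space)
qed

lemma times_map_invariant_of_fourier:
  assumes \<mu>: "circle_measure \<mu>" and eq: "\<And>k. fourier_coeff \<mu> (k * p) = fourier_coeff \<mu> k"
  shows "invariant_measure (times_map p) \<mu>"
proof (rule distr_invariant[OF times_map_measurable[OF \<mu>]])
  interpret prob_space \<mu> by (rule circle_measureD(1)[OF \<mu>])
  show "distr \<mu> \<mu> (times_map p) = \<mu>"
  proof (rule bp_closure_measure_eqI[where G = characters])
    show "prob_space \<mu>" by (rule circle_measureD(1)[OF \<mu>])
    show "prob_space (distr \<mu> \<mu> (times_map p))"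
      by (rule prob_space_distr[OF times_map_measurable[OF \<mu>]])
    show "bounded_measurable \<mu> g" if "g \<in> characters" for g
      by (rule characters_bounded_measurable[OF \<mu> that])
    show "indicator A \<in> bp_closure (space \<mu>) characters" if "A \<in> sets \<mu>" for A
      by (rule circle_indicator[OF \<mu> that])
    show "(LINT z|distr \<mu> \<mu> (times_map p). g z) = (LINT z|\<mu>. g z)" if "g \<in> characters" for g
    proof -
      obtain k where g: "g = (\<lambda>z. z powi k)" using \<open>g \<in> characters\<close> by (auto simp: characters_def)
      have "(LINT z|distr \<mu> \<mu> (times_map p). g z) = (LINT z|\<mu>. (times_map p z) powi k)"
        unfolding g
        by (rule integral_distr[OF times_map_measurable[OF \<mu>] circle_measurable_character[OF \<mu>]])
      also have "\<dots> = fourier_coeff \<mu> (k * p)"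
        using integral_character_times_map_funpow[OF \<mu>, where p = p and j = 1 and k = k and l = 0] by simp
      finally show ?thesis using eq by (simp add: g fourier_coeff_def)
    qed
  qed simp
qed

text \<open>Replacing \<open>k\<close> by \<open>k p\<close> shifts the sequence \<open>j \<mapsto> fourier_coeff (k p\<^sup>j)\<close> by one, and means along a
Folner sequence do not see the shift.\<close>

lemma times_map_invariant_of_mean_limit:
  assumes \<mu>: "circle_measure \<mu>" and F: "folner_sequence F"
    and lim: "\<And>k. (\<lambda>n. mean_over (F n) (\<lambda>j. fourier_coeff \<mu> (k * p ^ j))) \<longlonglongrightarrow> fourier_coeff \<mu> k"
  shows "invariant_measure (times_map p) \<mu>"
proof (rule times_map_invariant_of_fourier[OF \<mu>])
  fix k
  let ?a = "\<lambda>j. fourier_coeff \<mu> (k * p ^ j)"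
  have "norm (mean_over (F n) (\<lambda>j. ?a (Suc j)) - mean_over (F n) ?a)
      \<le> 1 * (real (card (sym_diff ((\<lambda>x. x + 1) ` F n) (F n))) / real (card (F n)))" for n
    by (intro folner_mean_over_shift folner_sequenceD[OF F] norm_fourier_coeff_le[OF \<mu>])
  then have "(\<lambda>n. mean_over (F n) (\<lambda>j. ?a (Suc j)) - mean_over (F n) ?a) \<longlonglongrightarrow> 0"
    by (intro Lim_null_comparison[OF always_eventually folner_shift_null[OF F, of 1]] allI)
  moreover have "(\<lambda>n. mean_over (F n) (\<lambda>j. ?a (Suc j)) - mean_over (F n) ?a)
      \<longlonglongrightarrow> fourier_coeff \<mu> (k * p) - fourier_coeff \<mu> k"
    using tendsto_diff[OF lim[of "k * p"] lim[of k]] by (simp add: mult.assoc)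
  ultimately have "fourier_coeff \<mu> (k * p) - fourier_coeff \<mu> k = 0"
    using LIMSEQ_unique by blast
  then show "fourier_coeff \<mu> (k * p) = fourier_coeff \<mu> k" by simp
qed

section \<open>Mixing properties and Fourier coefficients\<close>

lemma ergodic_iff_fourier:
  assumes \<mu>: "circle_measure \<mu>"
  shows "ergodic_measure (times_map p) \<mu> \<longleftrightarrow> (\<forall>F. folner_sequence F \<longrightarrow> (\<forall>k l.
    (\<lambda>n. mean_over (F n) (\<lambda>j. fourier_coeff \<mu> (k * p ^ j + l))) \<longlonglongrightarrow> fourier_coeff \<mu> k * fourier_coeff \<mu> l))"
proof (intro iffI allI impI)
  fix F k l
  assume "ergodic_measure (times_map p) \<mu>" "folner_sequence F"
  from ergodic_correlation[OF circle_measureD(1)[OF \<mu>] this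
      characters_bounded_measurable[OF \<mu> character_mem[of k]] characters_bounded_measurable[OF \<mu> character_mem[of l]]]
  show "(\<lambda>n. mean_over (F n) (\<lambda>j. fourier_coeff \<mu> (k * p ^ j + l))) \<longlonglongrightarrow> fourier_coeff \<mu> k * fourier_coeff \<mu> l"
    unfolding correlation_characters[OF \<mu>, abs_def] fourier_coeff_def .
next
  assume "\<forall>F. folner_sequence F \<longrightarrow> (\<forall>k l.
    (\<lambda>n. mean_over (F n) (\<lambda>j. fourier_coeff \<mu> (k * p ^ j + l))) \<longlonglongrightarrow> fourier_coeff \<mu> k * fourier_coeff \<mu> l)"
  then have lim: "(\<lambda>n. mean_over {..<Suc n} (\<lambda>j. fourier_coeff \<mu> (k * p ^ j + l)))
      \<longlonglongrightarrow> fourier_coeff \<mu> k * fourier_coeff \<mu> l" for k l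
    using folner_lessThan by blast
  show "ergodic_measure (times_map p) \<mu>"
  proof (rule ergodic_of_correlation_limit[where F = "\<lambda>n. {..<Suc n}" and G = characters])
    show "invariant_measure (times_map p) \<mu>"
      by (rule times_map_invariant_of_mean_limit[OF \<mu> folner_lessThan])
        (use lim[of _ 0] in \<open>simp add: fourier_coeff_0[OF \<mu>]\<close>)
    fix f g assume "f \<in> characters" "g \<in> characters"
    then obtain k l where fg: "f = (\<lambda>z. z powi k)" "g = (\<lambda>z. z powi l)" by (auto simp: characters_def)
    show "(\<lambda>n. mean_over {..<Suc n} (correlation (times_map p) \<mu> f g)) \<longlonglongrightarrow> (LINT z|\<mu>. f z) * (LINT z|\<mu>. g z)"
      using lim[of k l] unfolding fg correlation_characters[OF \<mu>, abs_def] fourier_coeff_def .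
  qed (use circle_measureD(1)[OF \<mu>] characters_bounded_measurable[OF \<mu>] circle_indicator[OF \<mu>] in auto)
qed

lemma weakly_mixing_iff_fourier:
  assumes \<mu>: "circle_measure \<mu>"
  shows "weakly_mixing_measure (times_map p) \<mu> \<longleftrightarrow> (\<forall>F. folner_sequence F \<longrightarrow> (\<forall>k l.
    (\<lambda>n. mean_over (F n) (\<lambda>j. (norm (fourier_coeff \<mu> (k * p ^ j + l)
      - fourier_coeff \<mu> k * fourier_coeff \<mu> l))\<^sup>2)) \<longlonglongrightarrow> 0))"
proof (intro iffI allI impI)
  fix F k l
  assume "weakly_mixing_measure (times_map p) \<mu>" "folner_sequence F"
  from weakly_mixing_correlation[OF circle_measureD(1)[OF \<mu>] this
      characters_bounded_measurable[OF \<mu> character_mem[of k]] characters_bounded_measurable[OF \<mu> character_mem[of l]]]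
  show "(\<lambda>n. mean_over (F n) (\<lambda>j. (norm (fourier_coeff \<mu> (k * p ^ j + l)
      - fourier_coeff \<mu> k * fourier_coeff \<mu> l))\<^sup>2)) \<longlonglongrightarrow> 0"
    unfolding correlation_characters[OF \<mu>] fourier_coeff_def .
next
  assume "\<forall>F. folner_sequence F \<longrightarrow> (\<forall>k l.
    (\<lambda>n. mean_over (F n) (\<lambda>j. (norm (fourier_coeff \<mu> (k * p ^ j + l)
      - fourier_coeff \<mu> k * fourier_coeff \<mu> l))\<^sup>2)) \<longlonglongrightarrow> 0)"
  then have lim: "(\<lambda>n. mean_over {..<Suc n} (\<lambda>j. (norm (fourier_coeff \<mu> (k * p ^ j + l)
      - fourier_coeff \<mu> k * fourier_coeff \<mu> l))\<^sup>2)) \<longlonglongrightarrow> 0" for k l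
    using folner_lessThan by blast
  note fin = folner_sequenceD[OF folner_lessThan]
  show "weakly_mixing_measure (times_map p) \<mu>"
  proof (rule weakly_mixing_of_mean_square_limit[where F = "\<lambda>n. {..<Suc n}" and G = characters])
    show "invariant_measure (times_map p) \<mu>"
      by (rule times_map_invariant_of_mean_limit[OF \<mu> folner_lessThan])
        (use mean_over_limit_of_mean_square[OF fin lim[of _ 0]] in \<open>simp add: fourier_coeff_0[OF \<mu>]\<close>)
    fix f g assume "f \<in> characters" "g \<in> characters"
    then obtain k l where fg: "f = (\<lambda>z. z powi k)" "g = (\<lambda>z. z powi l)" by (auto simp: characters_def)
    show "(\<lambda>n. mean_over {..<Suc n} (\<lambda>j. (norm (correlation (times_map p) \<mu> f g j
        - (LINT z|\<mu>. f z) * (LINT z|\<mu>. g z)))\<^sup>2)) \<longlonglongrightarrow> 0"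
      using lim[of k l] unfolding fg correlation_characters[OF \<mu>] fourier_coeff_def .
  qed (use circle_measureD(1)[OF \<mu>] characters_bounded_measurable[OF \<mu>] circle_indicator[OF \<mu>] in auto)
qed

lemma mean_over_singleton: "mean_over {n} a = a n"
  by (simp add: mean_over_def)

lemma strongly_mixing_iff_fourier:
  assumes \<mu>: "circle_measure \<mu>"
  shows "strongly_mixing_measure (times_map p) \<mu> \<longleftrightarrow>
    (\<forall>k l. (\<lambda>j. fourier_coeff \<mu> (k * p ^ j + l)) \<longlonglongrightarrow> fourier_coeff \<mu> k * fourier_coeff \<mu> l)"
proof (intro iffI allI)
  fix k l
  assume mix: "strongly_mixing_measure (times_map p) \<mu>"
  then have T: "invariant_measure (times_map p) \<mu>" by (simp add: strongly_mixing_measure_def)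
  have "(\<lambda>n. mean_over {n} (correlation (times_map p) \<mu> (\<lambda>z. z powi k) (\<lambda>z. z powi l)))
      \<longlonglongrightarrow> (LINT z|\<mu>. z powi k) * (LINT z|\<mu>. z powi l)"
  proof (rule correlation_limit_extension[OF circle_measureD(1)[OF \<mu>] T])
    fix f g :: "complex \<Rightarrow> complex" assume "f \<in> indicator ` sets \<mu>" "g \<in> indicator ` sets \<mu>"
    then obtain A B where A: "A \<in> sets \<mu>" "f = indicator A" and B: "B \<in> sets \<mu>" "g = indicator B" by blast
    have "(\<lambda>j. complex_of_real (measure \<mu> ((times_map p ^^ j) -` A \<inter> B)))
        \<longlonglongrightarrow> complex_of_real (measure \<mu> A * measure \<mu> B)"
      using mix A B by (intro tendsto_of_real) (auto simp: strongly_mixing_measure_def)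
    then show "(\<lambda>n. mean_over {n} (correlation (times_map p) \<mu> f g)) \<longlonglongrightarrow> (LINT z|\<mu>. f z) * (LINT z|\<mu>. g z)"
      using A B by (simp add: mean_over_singleton correlation_indicator[OF T] integral_complex_indicator)
    show "bounded_measurable \<mu> f"
      using A bounded_measurable_indicator by blast
  qed (auto intro: bounded_measurable_in_bp_closure_indicators
      characters_bounded_measurable[OF \<mu> character_mem])
  then show "(\<lambda>j. fourier_coeff \<mu> (k * p ^ j + l)) \<longlonglongrightarrow> fourier_coeff \<mu> k * fourier_coeff \<mu> l"
    unfolding mean_over_singleton correlation_characters[OF \<mu>] fourier_coeff_def .
next
  assume lim: "\<forall>k l. (\<lambda>j. fourier_coeff \<mu> (k * p ^ j + l)) \<longlonglongrightarrow> fourier_coeff \<mu> k * fourier_coeff \<mu> l"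
  have T: "invariant_measure (times_map p) \<mu>"
  proof (rule times_map_invariant_of_fourier[OF \<mu>])
    fix k
    have "(\<lambda>j. fourier_coeff \<mu> (k * p ^ Suc j)) \<longlonglongrightarrow> fourier_coeff \<mu> k"
      using LIMSEQ_Suc[OF lim[rule_format, of k 0]] by (simp add: fourier_coeff_0[OF \<mu>])
    moreover have "(\<lambda>j. fourier_coeff \<mu> (k * p ^ Suc j)) \<longlonglongrightarrow> fourier_coeff \<mu> (k * p)"
      using lim[rule_format, of "k * p" 0] by (simp add: fourier_coeff_0[OF \<mu>] mult.assoc)
    ultimately show "fourier_coeff \<mu> (k * p) = fourier_coeff \<mu> k"
      using LIMSEQ_unique by blast
  qed
  show "strongly_mixing_measure (times_map p) \<mu>"
    unfolding strongly_mixing_measure_def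
  proof (intro conjI T ballI)
    fix A B assume A: "A \<in> sets \<mu>" and B: "B \<in> sets \<mu>"
    have "(\<lambda>n. mean_over {n} (correlation (times_map p) \<mu> (indicator A) (indicator B)))
        \<longlonglongrightarrow> (LINT z|\<mu>. indicator A z) * (LINT z|\<mu>. indicator B z)"
    proof (rule correlation_limit_extension[OF circle_measureD(1)[OF \<mu>] T])
      fix f g assume "f \<in> characters" "g \<in> characters"
      then obtain k l where fg: "f = (\<lambda>z. z powi k)" "g = (\<lambda>z. z powi l)" by (auto simp: characters_def)
      show "(\<lambda>n. mean_over {n} (correlation (times_map p) \<mu> f g)) \<longlonglongrightarrow> (LINT z|\<mu>. f z) * (LINT z|\<mu>. g z)"
        using lim[rule_format, of k l]
        unfolding fg mean_over_singleton correlation_characters[OF \<mu>] fourier_coeff_def .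
    qed (use characters_bounded_measurable[OF \<mu>] circle_indicator[OF \<mu>] A B in auto)
    then have "(\<lambda>j. complex_of_real (measure \<mu> ((times_map p ^^ j) -` A \<inter> B)))
        \<longlonglongrightarrow> complex_of_real (measure \<mu> A * measure \<mu> B)"
      by (simp add: mean_over_singleton correlation_indicator[OF T A B] integral_complex_indicator A B)
    then show "(\<lambda>j. measure \<mu> ((times_map p ^^ j) -` A \<inter> B)) \<longlonglongrightarrow> measure \<mu> A * measure \<mu> B"
      by (simp only: tendsto_of_real_iff)
  qed
qed

theorem theorem4p1:
  fixes p :: int and \<mu> :: "complex measure"
  assumes "circle_measure \<mu>"
  shows
    "(ergodic_measure (times_map p) \<mu> \<longleftrightarrow>
        (\<forall>F. folner_sequence F \<longrightarrow> (\<forall>k l :: int.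
          (\<lambda>n. (\<Sum>j\<in>F n. fourier_coeff \<mu> (k * p ^ j + l)) / of_nat (card (F n)))
            \<longlonglongrightarrow> fourier_coeff \<mu> k * fourier_coeff \<mu> l)))
   \<and> (weakly_mixing_measure (times_map p) \<mu> \<longleftrightarrow>
        (\<forall>F. folner_sequence F \<longrightarrow> (\<forall>k l :: int.
          (\<lambda>n. (\<Sum>j\<in>F n. (norm (fourier_coeff \<mu> (k * p ^ j + l)
                              - fourier_coeff \<mu> k * fourier_coeff \<mu> l))\<^sup>2) / real (card (F n)))
            \<longlonglongrightarrow> 0)))
   \<and> (strongly_mixing_measure (times_map p) \<mu> \<longleftrightarrow>
        (\<forall>k l :: int.
          (\<lambda>j. fourier_coeff \<mu> (k * p ^ j + l))
            \<longlonglongrightarrow> fourier_coeff \<mu> k * fourier_coeff \<mu> l))"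
  using ergodic_iff_fourier[OF assms] weakly_mixing_iff_fourier[OF assms]
    strongly_mixing_iff_fourier[OF assms]
  unfolding mean_over_def by blast


end
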